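(* Suppose that $f$ is a homeomorphism of the circle $\mathbb{T}^1$, that $(\mathbb{T}^1,\mu,f)$ is uniquely ergodic and that $\mu$ is non-atomic. Then for every $m\geq 2$ there exists a non-uniform $A\in C(\mathbb{T}^1,\mathrm{GL}(m))$.
   Context: $\mathbb{T}^1=\{z\in\mathbb{C}:|z|=1\}$. "$(\mathbb{T}^1,\mu,f)$ is uniquely ergodic" means that $\mu$ is the only $f$-invariant Borel probability measure on $\mathbb{T}^1$. $\mathrm{GL}(m)$ is the set of invertible real $m\times m$ matrices and $C(X,\mathrm{GL}(m))$ is the set of continuous maps $X\to\mathrm{GL}(m)$. For $A\in C(X,\mathrm{GL}(m))$ and $n\geq1$ put $A(n,x)=A(f^{n-1}x)A(f^{n-2}x)\cdots A(x)$. $A$ is uniform if $\frac1n\log\|A(n,x)\|$ converges uniformly on $X$ as $n\to\infty$ (this does not depend on the choice of matrix norm), and non-uniform otherwise. *)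

theory Defs
  imports "HOL-Probability.Probability"
begin

abbreviation circle :: "complex set" where
  "circle \<equiv> sphere 0 1"

definition borel_prob_on :: "'a::topological_space set \<Rightarrow> 'a measure \<Rightarrow> bool" where
  "borel_prob_on X M \<longleftrightarrow> sets M = sets (restrict_space borel X) \<and> prob_space M"

definition invariant_measure :: "('a \<Rightarrow> 'a) \<Rightarrow> 'a measure \<Rightarrow> bool" where
  "invariant_measure f M \<longleftrightarrow>
     f \<in> measurable M M \<and> (\<forall>B\<in>sets M. emeasure M (f -` B \<inter> space M) = emeasure M B)"

definition uniquely_ergodic ::
    "'a::topological_space set \<Rightarrow> 'a measure \<Rightarrow> ('a \<Rightarrow> 'a) \<Rightarrow> bool" where
  "uniquely_ergodic X M f \<longleftrightarrow>
     borel_prob_on X M \<and> invariant_measure f M \<and>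
     (\<forall>N. borel_prob_on X N \<and> invariant_measure f N \<longrightarrow> N = M)"

text \<open>An atom is taken in the usual sense for finite measures: a set of positive measure
  with no measurable subset of strictly smaller positive measure.\<close>

definition atom_of :: "'a measure \<Rightarrow> 'a set \<Rightarrow> bool" where
  "atom_of M B \<longleftrightarrow> B \<in> sets M \<and> 0 < emeasure M B \<and>
     \<not> (\<exists>C\<in>sets M. C \<subseteq> B \<and> 0 < emeasure M C \<and> emeasure M C < emeasure M B)"

definition non_atomic :: "'a measure \<Rightarrow> bool" where
  "non_atomic M \<longleftrightarrow> \<not> (\<exists>B. atom_of M B)"

text \<open>Maps are total functions of which only the values on \<open>X\<close> matter.\<close>

definition continuous_GL_maps ::
    "'a::topological_space set \<Rightarrow> ('a \<Rightarrow> real ^ 'm ^ 'm) set" where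
  "continuous_GL_maps X = {A. continuous_on X A \<and> (\<forall>x\<in>X. invertible (A x))}"

primrec cocycle ::
    "('a \<Rightarrow> 'a) \<Rightarrow> ('a \<Rightarrow> real ^ 'm ^ 'm) \<Rightarrow> nat \<Rightarrow> 'a \<Rightarrow> real ^ 'm ^ 'm" where
  "cocycle f A 0 x = mat 1"
| "cocycle f A (Suc n) x = A ((f ^^ n) x) ** cocycle f A n x"

text \<open>The matrix norm is the operator norm for the Euclidean norm; the term for \<open>n = 0\<close> is
  immaterial.\<close>

definition uniform_cocycle ::
    "'a set \<Rightarrow> ('a \<Rightarrow> 'a) \<Rightarrow> ('a \<Rightarrow> real ^ 'm ^ 'm) \<Rightarrow> bool" where
  "uniform_cocycle X f A \<longleftrightarrow>
     uniformly_convergent_on X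
       (\<lambda>n x. 1 / real n * ln (onorm (\<lambda>v. cocycle f A n x *v v)))"

end

theory Submission
  imports Defs "HOL-Complex_Analysis.Complex_Analysis"
begin

text \<open>Since \<open>\<mu>\<close> has no atoms, \<open>f\<close> has no fixed point, hence preserves orientation, and the distribution
  function of \<open>\<mu>\<close> gives a continuous surjection \<open>h\<close> of the circle with \<open>h \<circ> f = \<kappa> h\<close>, \<open>|\<kappa>| = 1\<close>.
  Following Herman, let \<open>A x\<close> act on a coordinate plane as the rotation by \<open>h x\<close> followed by the
  diagonal matrix with entries \<open>2\<close> and \<open>1/2\<close>, and trivially on the other coordinates. By the maximum
  modulus principle the norm of the \<open>n\<close>-step product is somewhere at least of order \<open>(5/4)\<^sup>n\<close>.
  If \<open>A\<close> were uniform, the limit would be a continuous invariant function of \<open>h x\<close>, positive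
  somewhere. It cannot be positive everywhere, for then the most contracted direction would be a
  continuous invariant line field, and \<open>A\<close> changes the degree of such a field. So it is not
  constant, which contradicts the ergodicity of \<open>\<mu>\<close>.\<close>

section \<open>Degree of an invariant direction\<close>

text \<open>All values of \<open>D\<close> are multiples of 2 pi, so distinct values are at least 2
  pi apart, and continuity on the connected line leaves room for only one. Degrees are compared
  below by applying this to differences of arguments.\<close>

lemma continuous_cis_eq_1_constant:
  fixes D :: "real \<Rightarrow> real"
  assumes "continuous_on UNIV D" and "\<And>t. cis (D t) = 1"
  shows "D s = D t"
proof -
  have sep: "2 * pi \<le> \<bar>D y - D x\<bar>" if "D y \<noteq> D x" for x y
  proof -
    obtain i j :: int where ij: "D x = 2 * pi * i" "D y = 2 * pi * j"
      using assms(2)[of x] assms(2)[of y] by (auto simp: cis.ctr complex_eq_iff cos_one_2pi_int mult_ac)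
    with that have "i \<noteq> j" by auto
    then have "1 \<le> \<bar>real_of_int (j - i)\<bar>" by linarith
    then have "2 * pi * 1 \<le> 2 * pi * \<bar>real_of_int (j - i)\<bar>" by (intro mult_left_mono) auto
    also have "\<dots> = \<bar>D y - D x\<bar>" by (simp add: ij abs_mult flip: right_diff_distrib)
    finally show ?thesis by simp
  qed
  have "D constant_on UNIV"
  proof (rule continuous_discrete_range_constant)
    show "\<exists>e>0. \<forall>y. y \<in> UNIV \<and> D y \<noteq> D x \<longrightarrow> e \<le> norm (D y - D x)" for x
      using sep[of _ x] by (intro exI[of _ "2 * pi"]) (auto simp: real_norm_def)
  qed (use assms in auto)
  then show ?thesis by (auto simp: constant_on_def)
qed

lemma unit_circle_lift:
  fixes m :: "real \<Rightarrow> complex"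
  assumes "continuous_on UNIV m" and "\<And>t. cmod (m t) = 1"
  obtains L where "continuous_on UNIV L" "\<And>t. m t = cis (L t)"
proof -
  have "contractible (UNIV :: real set)" by (simp add: convex_imp_contractible)
  moreover have "m z \<noteq> 0" for z using assms(2)[of z] by auto
  ultimately obtain g where g: "continuous_on UNIV g" "\<And>t. m t = exp (g t)"
    using continuous_logarithm_on_contractible[OF assms(1)] by (metis UNIV_I)
  have "Re (g t) = 0" for t
    using assms(2)[of t] by (simp add: g(2))
  then have "m t = cis (Im (g t))" for t
    by (simp add: g(2) exp_eq_polar)
  with that[of "\<lambda>t. Im (g t)"] g(1) show thesis
    by (simp add: continuous_on_Im)
qed

text \<open>The degree of \<open>m\<close> would have to equal itself minus two, because the disc automorphism acts
  on the circle with degree one and is precomposed with a rotation.\<close>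

lemma no_continuous_invariant_direction:
  fixes m :: "complex \<Rightarrow> complex"
  assumes cont: "continuous_on circle m"
    and unit: "\<And>u. u \<in> circle \<Longrightarrow> cmod (m u) = 1"
    and \<kappa>: "cmod \<kappa> = 1" and c: "0 \<le> s" "s < c"
    and eq: "\<And>u. u \<in> circle \<Longrightarrow>
      m u = cnj u ^ 2 * ((of_real s + of_real c * m (\<kappa> * u)) / (of_real c + of_real s * m (\<kappa> * u)))"
  shows False
proof -
  define \<rho> where "\<rho> = Arg \<kappa>"
  have \<kappa>\<rho>: "\<kappa> = cis \<rho>"
    using rcis_cmod_Arg[of \<kappa>] \<kappa> by (simp add: \<rho>_def rcis_def)
  have "continuous_on UNIV (\<lambda>t. m (cis t))"
    by (rule continuous_on_compose2[OF cont]) (auto intro!: continuous_intros)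
  moreover have "cmod (m (cis t)) = 1" for t by (simp add: unit)
  ultimately obtain L where L: "continuous_on UNIV L" "\<And>t. m (cis t) = cis (L t)"
    by (rule unit_circle_lift) blast
  \<comment> \<open>With w = \<open>cis (L t)\<close>, the disc automorphism sends w to w * Y / cnj
    Y. Since \<open>s < c\<close>, Y stays in the right half-plane, so \<open>Arg (Y t)\<close> is a
    continuous argument that cannot wind around zero.\<close>
  define Y where "Y t = of_real c + of_real s * cis (- L t)" for t
  have Y: "Re (Y t) > 0" for t
  proof -
    have "- 1 * s \<le> s * cos (L t)" using mult_left_mono[OF cos_ge_minus_one c(1), of "L t"] by simp
    then show ?thesis using c by (simp add: Y_def)
  qed
  have contY: "continuous_on UNIV (\<lambda>t. Arg (Y (t + \<rho>)))"
  proof (rule continuous_on_compose2[where g = Arg and t = "{z. Re z > 0}"])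
    show "continuous_on {z. Re z > 0} Arg"
      by (intro continuous_at_imp_continuous_on ballI continuous_at_Arg) (auto simp: complex_nonpos_Reals_iff)
    show "continuous_on UNIV (\<lambda>t. Y (t + \<rho>))" unfolding Y_def
      by (intro continuous_intros continuous_on_compose2[OF L(1)]) auto
  qed (use Y in auto)
  have Moebius: "(of_real s + of_real c * cis (L t)) / (of_real c + of_real s * cis (L t))
      = cis (L t + 2 * Arg (Y t))" for t
  proof -
    have cY: "cnj (Y t) = of_real c + of_real s * cis (L t)" by (simp add: Y_def cis_cnj)
    have 1: "of_real s + of_real c * cis (L t) = cis (L t) * Y t"
      by (simp add: Y_def algebra_simps flip: cis_mult) (simp add: cis_mult)
    have pol: "Y t = of_real (cmod (Y t)) * cis (Arg (Y t))"
      using rcis_cmod_Arg[of "Y t"] by (simp add: rcis_def)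
    have nz: "cmod (Y t) \<noteq> 0" using Y[of t] by auto
    have "Y t / cnj (Y t) = cis (Arg (Y t)) / cis (- Arg (Y t))"
      using nz by (subst pol, subst (3) pol) (simp add: cis_cnj)
    also have "\<dots> = cis (2 * Arg (Y t))" by (simp add: cis_divide)
    finally have 2: "Y t / cnj (Y t) = cis (2 * Arg (Y t))" .
    show ?thesis unfolding 1 cY[symmetric] cis_mult[symmetric] 2[symmetric] by simp
  qed
  \<comment> \<open>\<open>D\<close> is the difference of continuous arguments of the two sides of
    \<open>eq\<close> at \<open>cis t\<close>; the factor \<open>cnj u ^ 2\<close> contributes the
    term 2 t.\<close>
  define D where "D t = L t + 2 * t - L (t + \<rho>) - 2 * Arg (Y (t + \<rho>))" for t
  have "cis (D t) = 1" for t
  proof -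
    have "cis (L t) = cis (- 2 * t) * cis (L (t + \<rho>) + 2 * Arg (Y (t + \<rho>)))"
    proof -
      have 1: "m (\<kappa> * cis t) = cis (L (t + \<rho>))"
        by (simp add: \<kappa>\<rho> cis_mult add.commute flip: L(2))
      have 2: "cnj (cis t) ^ 2 = cis (- 2 * t)"
        by (simp add: cis_cnj Complex.DeMoivre)
      show ?thesis
        using eq[of "cis t"] unfolding 1 2 Moebius by (simp add: L(2))
    qed
    then have "cis (L t) = cis (- 2 * t + (L (t + \<rho>) + 2 * Arg (Y (t + \<rho>))))"
      by (simp only: cis_mult)
    then have "cis (L t) / cis (- 2 * t + (L (t + \<rho>) + 2 * Arg (Y (t + \<rho>)))) = 1" by simp
    then show ?thesis unfolding cis_divide D_def by (simp add: algebra_simps)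
  qed
  moreover have "continuous_on UNIV D" unfolding D_def
    by (intro continuous_intros contY L(1) continuous_on_compose2[OF L(1)]) auto
  ultimately have D: "D (2 * pi) = D 0" by (rule continuous_cis_eq_1_constant[rotated])
  have per: "cis (L (t + 2 * pi)) = cis (L t)" for t
    using L(2)[of t] L(2)[of "t + 2 * pi"] by (simp flip: cis_mult)
  \<comment> \<open>The increment of \<open>L\<close> over a full turn does not depend on the
    starting point, and \<open>Y\<close> returns to its value. Over a full turn \<open>D\<close>
    therefore gains exactly 4 pi, although it is constant.\<close>
  have "L (0 + 2 * pi) - L 0 = L (\<rho> + 2 * pi) - L \<rho>"
  proof (rule continuous_cis_eq_1_constant[of "\<lambda>t. L (t + 2 * pi) - L t"])
    show "continuous_on UNIV (\<lambda>t. L (t + 2 * pi) - L t)"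
      by (intro continuous_intros L(1) continuous_on_compose2[OF L(1)]) auto
    show "cis (L (t + 2 * pi) - L t) = 1" for t
      using per[of t] by (simp flip: cis_divide)
  qed
  moreover have "Y (\<rho> + 2 * pi) = Y \<rho>"
    using per[of \<rho>] by (simp add: Y_def flip: cis_cnj)
  ultimately show False using D pi_gt_zero by (simp add: D_def add.commute)
qed

section \<open>Products of planar maps over a rotation\<close>

text \<open>A pair \<open>(a, b)\<close> of complex numbers encodes the real-linear map \<open>z \<mapsto> a z + b cnj z\<close> of the
  plane, whose determinant is \<open>|a|\<^sup>2 - |b|\<^sup>2\<close>. The pair below encodes the \<open>n\<close>-step product over
  the rotation by \<open>\<kappa>\<close> of the maps with \<open>a = 5/4 u\<close> and \<open>b = 3/4 cnj u\<close>: rotate by \<open>u\<close>, then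
  stretch by \<open>2\<close> and \<open>1/2\<close> along the axes.\<close>

primrec prodpair :: "complex \<Rightarrow> nat \<Rightarrow> complex \<Rightarrow> complex \<times> complex" where
  "prodpair \<kappa> 0 u = (1, 0)"
| "prodpair \<kappa> (Suc n) u =
    (5/4 * (\<kappa> ^ n * u) * fst (prodpair \<kappa> n u) + 3/4 * cnj (\<kappa> ^ n * u) * cnj (snd (prodpair \<kappa> n u)),
     5/4 * (\<kappa> ^ n * u) * snd (prodpair \<kappa> n u) + 3/4 * cnj (\<kappa> ^ n * u) * cnj (fst (prodpair \<kappa> n u)))"

abbreviation "pa \<kappa> n u \<equiv> fst (prodpair \<kappa> n u)"
abbreviation "pb \<kappa> n u \<equiv> snd (prodpair \<kappa> n u)"

text \<open>The defining recursion multiplies by the last factor on the left; here the first factor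
  is split off on the right, leaving the product that starts at \<open>\<kappa> * u\<close>. This
  relates the behaviour at \<open>u\<close> to that at \<open>\<kappa> * u\<close>.\<close>

lemma prodpair_Suc_right:
  "pa \<kappa> (Suc n) u = 5/4 * u * pa \<kappa> n (\<kappa> * u) + 3/4 * u * pb \<kappa> n (\<kappa> * u)"
  "pb \<kappa> (Suc n) u = 3/4 * cnj u * pa \<kappa> n (\<kappa> * u) + 5/4 * cnj u * pb \<kappa> n (\<kappa> * u)"
proof (induction n)
  case (Suc n)
  have "pa \<kappa> (Suc (Suc n)) u = 5/4 * (\<kappa> ^ Suc n * u) * pa \<kappa> (Suc n) u
      + 3/4 * cnj (\<kappa> ^ Suc n * u) * cnj (pb \<kappa> (Suc n) u)"
    by (simp only: prodpair.simps(2)[of _ "Suc n"] fst_conv)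
  also have "\<dots> = 5/4 * u * pa \<kappa> (Suc n) (\<kappa> * u) + 3/4 * u * pb \<kappa> (Suc n) (\<kappa> * u)"
    unfolding Suc prodpair.simps(2)[of _ n "\<kappa> * u"] by (simp add: algebra_simps)
  finally show "pa \<kappa> (Suc (Suc n)) u = 5/4 * u * pa \<kappa> (Suc n) (\<kappa> * u) + 3/4 * u * pb \<kappa> (Suc n) (\<kappa> * u)" .
  have "pb \<kappa> (Suc (Suc n)) u = 5/4 * (\<kappa> ^ Suc n * u) * pb \<kappa> (Suc n) u
      + 3/4 * cnj (\<kappa> ^ Suc n * u) * cnj (pa \<kappa> (Suc n) u)"
    by (simp only: prodpair.simps(2)[of _ "Suc n"] snd_conv)
  also have "\<dots> = 3/4 * cnj u * pa \<kappa> (Suc n) (\<kappa> * u) + 5/4 * cnj u * pb \<kappa> (Suc n) (\<kappa> * u)"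
    unfolding Suc prodpair.simps(2)[of _ n "\<kappa> * u"] by (simp add: algebra_simps)
  finally show "pb \<kappa> (Suc (Suc n)) u = 3/4 * cnj u * pa \<kappa> (Suc n) (\<kappa> * u) + 5/4 * cnj u * pb \<kappa> (Suc n) (\<kappa> * u)" .
qed auto

lemma unit_mult_cnj: "cmod z = 1 \<Longrightarrow> z * cnj z = 1"
  by (simp add: complex_norm_square[symmetric])

text \<open>The determinant is multiplicative, and each factor has determinant (5/4)^2 - (3/4)^2 =
  1.\<close>

lemma prodpair_det:
  assumes "cmod \<kappa> = 1" "cmod u = 1"
  shows "pa \<kappa> n u * cnj (pa \<kappa> n u) - pb \<kappa> n u * cnj (pb \<kappa> n u) = 1"
proof (induction n)
  case (Suc n)
  define v where "v = \<kappa> ^ n * u"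
  have v: "v * cnj v = 1"
    by (rule unit_mult_cnj) (simp add: v_def norm_mult norm_power assms)
  define a b where "a = pa \<kappa> n u" and "b = pb \<kappa> n u"
  have eqs: "pa \<kappa> (Suc n) u = 5/4 * v * a + 3/4 * cnj v * cnj b"
    "pb \<kappa> (Suc n) u = 5/4 * v * b + 3/4 * cnj v * cnj a"
    by (simp_all add: v_def a_def b_def)
  have "pa \<kappa> (Suc n) u * cnj (pa \<kappa> (Suc n) u) - pb \<kappa> (Suc n) u * cnj (pb \<kappa> (Suc n) u)
      = (v * cnj v) * (a * cnj a - b * cnj b)"
    unfolding eqs by (simp add: algebra_simps)
  also have "\<dots> = 1" using Suc v by (simp add: a_def b_def)
  finally show ?case .
qed auto

lemma prodpair_det_norm:
  assumes "cmod \<kappa> = 1" "cmod u = 1"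
  shows "cmod (pa \<kappa> n u) ^ 2 = 1 + cmod (pb \<kappa> n u) ^ 2"
proof -
  have "complex_of_real (cmod (pa \<kappa> n u) ^ 2) = complex_of_real (1 + cmod (pb \<kappa> n u) ^ 2)"
    using prodpair_det[OF assms, of n]
    by (simp add: complex_norm_square algebra_simps del: of_real_power)
  then show ?thesis by (simp only: of_real_eq_iff)
qed

lemma norm_pb_le_pa:
  assumes "cmod \<kappa> = 1" "cmod u = 1"
  shows "cmod (pb \<kappa> n u) \<le> cmod (pa \<kappa> n u)"
  by (rule power2_le_imp_le) (use prodpair_det_norm[OF assms, of n] in auto)

lemma norm_pa_ge_1:
  assumes "cmod \<kappa> = 1" "cmod u = 1"
  shows "1 \<le> cmod (pa \<kappa> n u)"
  by (rule power2_le_imp_le) (use prodpair_det_norm[OF assms, of n] in auto)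

text \<open>Up to a unimodular factor the new coefficient is 5/4 a + 3/4 b with |b| at most |a|, so
  its modulus lies between (5/4 - 3/4) |a| and (5/4 + 3/4) |a|.\<close>

lemma norm_pa_Suc_bounds:
  assumes "cmod \<kappa> = 1" "cmod u = 1"
  shows "cmod (pa \<kappa> (Suc n) u) \<le> 2 * cmod (pa \<kappa> n (\<kappa> * u))"
    and "cmod (pa \<kappa> n (\<kappa> * u)) \<le> 2 * cmod (pa \<kappa> (Suc n) u)"
proof -
  have ku: "cmod (\<kappa> * u) = 1" by (simp add: norm_mult assms)
  have eq: "cmod (pa \<kappa> (Suc n) u) = cmod (5/4 * pa \<kappa> n (\<kappa> * u) + 3/4 * pb \<kappa> n (\<kappa> * u))"
  proof -
    have "pa \<kappa> (Suc n) u = u * (5/4 * pa \<kappa> n (\<kappa> * u) + 3/4 * pb \<kappa> n (\<kappa> * u))"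
      by (subst prodpair_Suc_right) (simp only: distrib_left mult_ac)
    then show ?thesis by (simp only: norm_mult assms mult_1)
  qed
  have n: "cmod (5/4 * pa \<kappa> n (\<kappa> * u)) = 5/4 * cmod (pa \<kappa> n (\<kappa> * u))"
    "cmod (3/4 * pb \<kappa> n (\<kappa> * u)) = 3/4 * cmod (pb \<kappa> n (\<kappa> * u))"
    by (simp_all add: norm_mult norm_divide)
  show "cmod (pa \<kappa> (Suc n) u) \<le> 2 * cmod (pa \<kappa> n (\<kappa> * u))"
    using norm_triangle_ineq[of "5/4 * pa \<kappa> n (\<kappa> * u)" "3/4 * pb \<kappa> n (\<kappa> * u)"]
      norm_pb_le_pa[OF assms(1) ku, of n] by (simp only: eq n)
  show "cmod (pa \<kappa> n (\<kappa> * u)) \<le> 2 * cmod (pa \<kappa> (Suc n) u)"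
    using norm_diff_ineq[of "5/4 * pa \<kappa> n (\<kappa> * u)" "3/4 * pb \<kappa> n (\<kappa> * u)"]
      norm_pb_le_pa[OF assms(1) ku, of n] by (simp only: eq n)
qed

lemma continuous_on_prodpair:
  "continuous_on S (\<lambda>u. pa \<kappa> n u)" "continuous_on S (\<lambda>u. pb \<kappa> n u)"
  by (induction n) (auto intro!: continuous_intros)

text \<open>As functions of \<open>w = cnj u\<close>, the quantities \<open>w\<^sup>n a\<close> and \<open>w\<^sup>n cnj b\<close> are polynomials, and the
  constant coefficient of the first has modulus \<open>(5/4)\<^sup>n\<close>.\<close>

lemma prodpair_growth:
  assumes \<kappa>: "cmod \<kappa> = 1"
  shows "\<exists>u\<in>circle. (5/4) ^ n \<le> cmod (pa \<kappa> n u)"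
proof -
  \<comment> \<open>The components of \<open>P n\<close> are the two polynomials in w. The square of
    w arises from rewriting \<open>cnj u\<close> as \<open>u * (cnj u)\<^sup>2\<close>, so that both
    terms of each recursion step release one factor \<open>u\<close>.\<close>
  define P where "P = rec_nat (\<lambda>_. 1, \<lambda>_. 0) (\<lambda>n (p, q).
     (\<lambda>w. 5/4 * \<kappa> ^ n * p w + 3/4 * cnj \<kappa> ^ n * w\<^sup>2 * q w :: complex,
      \<lambda>w. 5/4 * cnj \<kappa> ^ n * w\<^sup>2 * q w + 3/4 * \<kappa> ^ n * p w :: complex))"
  have P0: "fst (P 0) w = 1" "snd (P 0) w = 0" for w by (simp_all add: P_def)
  have PS: "fst (P (Suc n)) w = 5/4 * \<kappa> ^ n * fst (P n) w + 3/4 * cnj \<kappa> ^ n * w\<^sup>2 * snd (P n) w"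
    "snd (P (Suc n)) w = 5/4 * cnj \<kappa> ^ n * w\<^sup>2 * snd (P n) w + 3/4 * \<kappa> ^ n * fst (P n) w" for n w
    by (simp_all add: P_def split: prod.splits)
  have hol: "fst (P n) holomorphic_on UNIV \<and> snd (P n) holomorphic_on UNIV" for n
  proof (induction n)
    case 0 then show ?case by (simp add: P_def)
  next
    case (Suc n)
    have eqs: "fst (P (Suc n)) = (\<lambda>w. 5/4 * \<kappa> ^ n * fst (P n) w + 3/4 * cnj \<kappa> ^ n * w\<^sup>2 * snd (P n) w)"
      "snd (P (Suc n)) = (\<lambda>w. 5/4 * cnj \<kappa> ^ n * w\<^sup>2 * snd (P n) w + 3/4 * \<kappa> ^ n * fst (P n) w)"
      using PS by auto
    show ?case unfolding eqs using Suc by (auto intro!: holomorphic_intros)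
  qed
  have at0: "cmod (fst (P n) 0) = (5/4) ^ n" for n
    by (induction n) (simp_all add: P0 PS norm_mult norm_divide norm_power \<kappa>)
  have rel: "pa \<kappa> n u = u ^ n * fst (P n) (cnj u) \<and> cnj (pb \<kappa> n u) = u ^ n * snd (P n) (cnj u)"
    if u: "cmod u = 1" for n u
  proof (induction n)
    case (Suc n)
    then have 1: "pa \<kappa> n u = u ^ n * fst (P n) (cnj u)" "cnj (pb \<kappa> n u) = u ^ n * snd (P n) (cnj u)" by auto
    have 2: "cnj u = u * (cnj u)\<^sup>2"
      using unit_mult_cnj[OF u] by (simp add: power2_eq_square flip: mult.assoc)
    have "pa \<kappa> (Suc n) u = 5/4 * (\<kappa> ^ n * u) * pa \<kappa> n u + 3/4 * (cnj \<kappa> ^ n * cnj u) * cnj (pb \<kappa> n u)"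
      by simp
    also have "\<dots> = 5/4 * (\<kappa> ^ n * u) * pa \<kappa> n u + 3/4 * (cnj \<kappa> ^ n * (u * (cnj u)\<^sup>2)) * cnj (pb \<kappa> n u)"
      by (simp only: flip: 2)
    also have "\<dots> = u ^ Suc n * fst (P (Suc n)) (cnj u)"
      unfolding 1 PS by (simp add: algebra_simps)
    finally have A: "pa \<kappa> (Suc n) u = u ^ Suc n * fst (P (Suc n)) (cnj u)" .
    have "cnj (pb \<kappa> (Suc n) u) = 5/4 * (cnj \<kappa> ^ n * cnj u) * cnj (pb \<kappa> n u) + 3/4 * (\<kappa> ^ n * u) * pa \<kappa> n u"
      by simp
    also have "\<dots> = 5/4 * (cnj \<kappa> ^ n * (u * (cnj u)\<^sup>2)) * cnj (pb \<kappa> n u) + 3/4 * (\<kappa> ^ n * u) * pa \<kappa> n u"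
      by (simp only: flip: 2)
    also have "\<dots> = u ^ Suc n * snd (P (Suc n)) (cnj u)"
      unfolding 1 PS by (simp add: algebra_simps)
    finally show ?case using A by blast
  qed (simp add: P0)
  show ?thesis
  proof (rule ccontr)
    assume "\<not> ?thesis"
    then have less: "cmod (pa \<kappa> n u) < (5/4) ^ n" if "cmod u = 1" for u
      using that by (force simp: not_le)
    have "continuous_on circle (\<lambda>u. cmod (pa \<kappa> n u))"
      by (intro continuous_on_norm continuous_on_prodpair)
    then have "\<exists>u0\<in>circle. \<forall>u\<in>circle. cmod (pa \<kappa> n u) \<le> cmod (pa \<kappa> n u0)"
      by (intro continuous_attains_sup) auto
    then obtain u0 where u0: "u0 \<in> circle" "\<And>u. u \<in> circle \<Longrightarrow> cmod (pa \<kappa> n u) \<le> cmod (pa \<kappa> n u0)"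
      by blast
    have "cmod (fst (P n) 0) \<le> cmod (pa \<kappa> n u0)"
    proof (rule maximum_modulus_frontier[where f = "fst (P n)" and S = "cball 0 1" and \<xi> = 0])
      show "fst (P n) holomorphic_on interior (cball 0 1)"
        using hol holomorphic_on_subset by blast
      show "continuous_on (closure (cball 0 1)) (fst (P n))"
        using hol holomorphic_on_imp_continuous_on continuous_on_subset by blast
      show "cmod (fst (P n) z) \<le> cmod (pa \<kappa> n u0)" if "z \<in> frontier (cball 0 1)" for z
      proof -
        have z: "cmod (cnj z) = 1" using that by simp
        have "cmod (pa \<kappa> n (cnj z)) = cmod (fst (P n) z)"
          using rel[OF z, of n] z by (simp add: norm_mult norm_power)
        then show ?thesis using u0(2)[of "cnj z"] z by simp
      qed
    qed auto
    with less[of u0] u0(1) show False by (simp add: at0)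
  qed
qed

text \<open>Over the common denominator the numerator is 3/4 \<open>cnj (\<kappa> ^ n * u)\<close>
  times the determinant, which is 1. Growth of the denominators thus makes the ratios
  converge.\<close>

lemma prodpair_ratio_diff:
  assumes "cmod \<kappa> = 1" "cmod u = 1"
  shows "pb \<kappa> (Suc n) u / pa \<kappa> (Suc n) u - pb \<kappa> n u / pa \<kappa> n u
    = 3/4 * cnj (\<kappa> ^ n * u) / (pa \<kappa> n u * pa \<kappa> (Suc n) u)"
proof -
  define v where "v = \<kappa> ^ n * u"
  define a b where "a = pa \<kappa> n u" and "b = pb \<kappa> n u"
  have nz: "pa \<kappa> k u \<noteq> 0" for k using norm_pa_ge_1[OF assms, of k] by auto
  have eqs: "pa \<kappa> (Suc n) u = 5/4 * v * a + 3/4 * cnj v * cnj b"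
    "pb \<kappa> (Suc n) u = 5/4 * v * b + 3/4 * cnj v * cnj a"
    by (simp_all add: v_def a_def b_def)
  have "pb \<kappa> (Suc n) u * a - b * pa \<kappa> (Suc n) u = 3/4 * cnj v * (a * cnj a - b * cnj b)"
    unfolding eqs by (simp add: algebra_simps)
  also have "\<dots> = 3/4 * cnj v"
    using prodpair_det[OF assms, of n] by (simp add: a_def b_def)
  finally have "pb \<kappa> (Suc n) u * a - b * pa \<kappa> (Suc n) u = 3/4 * cnj v" .
  then show ?thesis
    using nz[of n] nz[of "Suc n"] unfolding v_def[symmetric] a_def[symmetric] b_def[symmetric]
    by (simp only: diff_frac_eq mult.commute simp_thms)
qed

text \<open>If the growth were exponential everywhere, \<open>b / a\<close> would converge uniformly to a continuous
  unimodular function, which encodes the contracted direction.\<close>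

lemma prodpair_not_uniformly_growing:
  assumes \<kappa>: "cmod \<kappa> = 1" and "\<delta> > 0"
    and growth: "\<forall>\<^sub>F n in sequentially. \<forall>u\<in>circle. exp (real n * \<delta>) \<le> cmod (pa \<kappa> n u)"
  shows False
proof -
  define r where "r n u = pb \<kappa> n u / pa \<kappa> n u" for n u
  have "uniformly_convergent_on circle (\<lambda>n u. \<Sum>k<n. r (Suc k) u - r k u)"
  proof (rule Weierstrass_m_test'_ev)
    show "\<forall>\<^sub>F n in sequentially. \<forall>u\<in>circle. cmod (r (Suc n) u - r n u) \<le> exp (- \<delta>) ^ n"
      using growth
    proof eventually_elim
      case (elim n)
      show ?case
      proof
        fix u assume "u \<in> circle"
        then have u: "cmod u = 1" by simp
        have "cmod (r (Suc n) u - r n u) = 3/4 / (cmod (pa \<kappa> n u) * cmod (pa \<kappa> (Suc n) u))"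
          unfolding r_def prodpair_ratio_diff[OF \<kappa> u]
          by (simp add: norm_mult norm_divide norm_power \<kappa> u del: prodpair.simps)
        \<comment> \<open>Exponential growth of one of the two factors already gives a geometric
          majorant; the other is bounded below by 1.\<close>
        also have "\<dots> \<le> 1 / (exp (real n * \<delta>) * 1)"
          using elim[rule_format, OF \<open>u \<in> circle\<close>] norm_pa_ge_1[OF \<kappa> u, of "Suc n"]
          by (intro frac_le mult_mono) (auto simp del: prodpair.simps)
        also have "\<dots> = exp (- \<delta>) ^ n"
          by (simp add: exp_minus inverse_eq_divide power_one_over flip: exp_of_nat_mult)
        finally show "cmod (r (Suc n) u - r n u) \<le> exp (- \<delta>) ^ n" .
      qed
    qed
    show "summable (\<lambda>n. exp (- \<delta>) ^ n)"
      using \<open>\<delta> > 0\<close> by (intro summable_geometric) simp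
  qed
  moreover have "(\<Sum>k<n. r (Suc k) u - r k u) = r n u" for n u
    using sum_lessThan_telescope[of "\<lambda>k. r k u" n] by (simp add: r_def[of 0])
  ultimately obtain m where m: "uniform_limit circle r m sequentially"
    by (auto simp: uniformly_convergent_on_def)
  have lim: "(\<lambda>n. r n u) \<longlonglongrightarrow> m u" if "u \<in> circle" for u
    using tendsto_uniform_limitI[OF m that] .
  show False
  proof (rule no_continuous_invariant_direction[of m \<kappa> "3/4" "5/4"])
    have "continuous_on circle (r n)" for n
      unfolding r_def
    proof (intro continuous_on_divide continuous_on_prodpair ballI)
      show "pa \<kappa> n u \<noteq> 0" if "u \<in> circle" for u
        using norm_pa_ge_1[OF \<kappa>, of u n] that by auto
    qed
    then show "continuous_on circle m"
      by (intro uniform_limit_theorem[OF _ m]) auto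
  next
    fix u :: complex assume uc: "u \<in> circle"
    then have u: "cmod u = 1" by simp
    \<comment> \<open>By the determinant identity |r|^2 = 1 - 1/|a|^2, so divergence of |a| forces
      the limit onto the unit circle.\<close>
    have "filterlim (\<lambda>n. cmod (pa \<kappa> n u)) at_top sequentially"
    proof (rule filterlim_at_top_mono)
      show "\<forall>\<^sub>F n in sequentially. exp (real n * \<delta>) \<le> cmod (pa \<kappa> n u)"
        using growth by eventually_elim (use uc in auto)
      show "filterlim (\<lambda>n. exp (real n * \<delta>)) at_top sequentially"
        using \<open>\<delta> > 0\<close> by real_asymp
    qed
    then have "(\<lambda>n. inverse (cmod (pa \<kappa> n u))) \<longlonglongrightarrow> 0"
      by (rule tendsto_inverse_0_at_top)
    then have "(\<lambda>n. 1 - (inverse (cmod (pa \<kappa> n u)))\<^sup>2) \<longlonglongrightarrow> 1 - 0\<^sup>2"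
      by (intro tendsto_diff tendsto_power tendsto_const)
    moreover have "(cmod (r n u))\<^sup>2 = 1 - (inverse (cmod (pa \<kappa> n u)))\<^sup>2" for n
    proof -
      have nz: "cmod (pa \<kappa> n u) \<noteq> 0" using norm_pa_ge_1[OF \<kappa> u, of n] by linarith
      have "(cmod (r n u))\<^sup>2 = (cmod (pb \<kappa> n u))\<^sup>2 / (cmod (pa \<kappa> n u))\<^sup>2"
        by (simp add: r_def norm_divide power_divide)
      also have "\<dots> = ((cmod (pa \<kappa> n u))\<^sup>2 - 1) / (cmod (pa \<kappa> n u))\<^sup>2"
        by (simp add: prodpair_det_norm[OF \<kappa> u])
      finally show ?thesis using nz
        by (simp add: diff_divide_distrib inverse_eq_divide power_divide)
    qed
    ultimately have "(\<lambda>n. (cmod (r n u))\<^sup>2) \<longlonglongrightarrow> 1" by simp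
    moreover have "(\<lambda>n. (cmod (r n u))\<^sup>2) \<longlonglongrightarrow> (cmod (m u))\<^sup>2"
      by (intro tendsto_power tendsto_norm lim uc)
    ultimately have "(cmod (m u))\<^sup>2 = 1" using LIMSEQ_unique by blast
    then show "cmod (m u) = 1" by (simp add: power2_eq_1_iff) (use norm_ge_zero[of "m u"] in linarith)
  next
    fix u :: complex assume uc: "u \<in> circle"
    then have u: "cmod u = 1" by simp
    have ku: "\<kappa> * u \<in> circle" using u \<kappa> by (simp add: norm_mult)
    then have ku': "cmod (\<kappa> * u) = 1" by simp
    \<comment> \<open>Splitting off the first factor turns into a Moebius relation between the
      ratios at \<open>u\<close> and \<open>\<kappa> * u\<close>. Its limit is the functional
      equation with s = 3/4 and c = 5/4.\<close>
    have step: "r (Suc n) u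
      = (cnj u)\<^sup>2 * ((of_real (3/4) + of_real (5/4) * r n (\<kappa> * u)) / (of_real (5/4) + of_real (3/4) * r n (\<kappa> * u)))" for n
    proof -
      have nz: "pa \<kappa> n (\<kappa> * u) \<noteq> 0" using norm_pa_ge_1[OF \<kappa> ku', of n] by auto
      have inv: "cnj u = 1 / u" using unit_mult_cnj[OF u]
        by (simp add: eq_divide_eq mult.commute)
      have "r (Suc n) u = (cnj u / u) * ((3/4 * pa \<kappa> n (\<kappa> * u) + 5/4 * pb \<kappa> n (\<kappa> * u))
          / (5/4 * pa \<kappa> n (\<kappa> * u) + 3/4 * pb \<kappa> n (\<kappa> * u)))"
        unfolding r_def prodpair_Suc_right times_divide_times_eq by (simp only: distrib_left mult_ac)
      also have "(3/4 * pa \<kappa> n (\<kappa> * u) + 5/4 * pb \<kappa> n (\<kappa> * u))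
          / (5/4 * pa \<kappa> n (\<kappa> * u) + 3/4 * pb \<kappa> n (\<kappa> * u))
          = (pa \<kappa> n (\<kappa> * u) * (3/4 + 5/4 * r n (\<kappa> * u)))
          / (pa \<kappa> n (\<kappa> * u) * (5/4 + 3/4 * r n (\<kappa> * u)))"
        using nz by (simp add: r_def distrib_left mult.commute)
      also have "\<dots> = (3/4 + 5/4 * r n (\<kappa> * u)) / (5/4 + 3/4 * r n (\<kappa> * u))"
        using nz by simp
      finally show ?thesis by (simp add: inv power2_eq_square)
    qed
    \<comment> \<open>A zero of the denominator would need |m| = 5/3, whereas limits of the ratios
      have modulus at most 1.\<close>
    have nz: "of_real (5/4) + of_real (3/4) * m (\<kappa> * u) \<noteq> 0"
    proof
      assume "of_real (5/4) + of_real (3/4) * m (\<kappa> * u) = 0"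
      then have "3 * m (\<kappa> * u) = - 5" by (simp add: field_simps add_eq_0_iff)
      then have "cmod (3 * m (\<kappa> * u)) = 5" by simp
      moreover have "cmod (m (\<kappa> * u)) \<le> 1"
      proof (rule LIMSEQ_le_const2[OF tendsto_norm[OF lim[OF ku]]])
        show "\<exists>N. \<forall>n\<ge>N. cmod (r n (\<kappa> * u)) \<le> 1"
          using norm_pb_le_pa[OF \<kappa> ku'] norm_pa_ge_1[OF \<kappa> ku']
          by (auto simp: r_def norm_divide intro!: divide_le_eq_1[THEN iffD2])
      qed
      ultimately show False by (simp add: norm_mult)
    qed
    show "m u = (cnj u)\<^sup>2 * ((of_real (3/4) + of_real (5/4) * m (\<kappa> * u)) / (of_real (5/4) + of_real (3/4) * m (\<kappa> * u)))"
      using LIMSEQ_Suc[OF lim[OF uc]] unfolding step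
      by (rule LIMSEQ_unique) (intro tendsto_mult tendsto_divide tendsto_add tendsto_const lim ku nz)
  qed (use \<kappa> in auto)
qed

text \<open>The maximum modulus bound makes the rate positive somewhere, and the degree obstruction
  prevents it from being positive everywhere. This yields a non-constant continuous function
  invariant under the rotation.\<close>

lemma prodpair_growth_rate:
  assumes \<kappa>: "cmod \<kappa> = 1"
    and unif: "uniform_limit circle (\<lambda>n u. 1 / real n * ln (cmod (pa \<kappa> n u))) \<psi> sequentially"
  shows "continuous_on circle \<psi>"
    and "\<And>u. u \<in> circle \<Longrightarrow> \<psi> (\<kappa> * u) = \<psi> u"
    and "\<exists>u\<in>circle. \<exists>v\<in>circle. \<psi> u < \<psi> v"
proof -
  have pos: "pa \<kappa> n u \<noteq> 0" "cmod (pa \<kappa> n u) > 0" if "u \<in> circle" for n u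
    using norm_pa_ge_1[OF \<kappa>, of u n] that by auto
  show cont: "continuous_on circle \<psi>"
  proof (rule uniform_limit_theorem[OF _ unif])
    show "\<forall>\<^sub>F n in sequentially. continuous_on circle (\<lambda>u. 1 / real n * ln (cmod (pa \<kappa> n u)))"
      by (intro always_eventually allI continuous_intros continuous_on_prodpair)
        (use pos in auto)
  qed auto
  have lim: "(\<lambda>n. 1 / real n * ln (cmod (pa \<kappa> n u))) \<longlonglongrightarrow> \<psi> u" if "u \<in> circle" for u
    using tendsto_uniform_limitI[OF unif that] .
  show "\<psi> (\<kappa> * u) = \<psi> u" if uc: "u \<in> circle" for u
  proof -
    have u: "cmod u = 1" using uc by simp
    have ku: "\<kappa> * u \<in> circle" using u \<kappa> by (simp add: norm_mult)
    define x y where "x n = ln (cmod (pa \<kappa> n (\<kappa> * u)))" and "y n = ln (cmod (pa \<kappa> n u))" for n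
    \<comment> \<open>Removing the first factor costs at most a factor 2 in modulus, hence a bounded
      amount in the logarithm, which disappears after division by n.\<close>
    have xy: "\<bar>y (Suc n) - x n\<bar> \<le> ln 2" for n
    proof -
      have "y (Suc n) \<le> ln (2 * cmod (pa \<kappa> n (\<kappa> * u)))"
        unfolding y_def using norm_pa_Suc_bounds(1)[OF \<kappa> u, of n] pos[OF uc, of "Suc n"]
        by (intro ln_mono) (auto simp del: prodpair.simps)
      moreover have "x n \<le> ln (2 * cmod (pa \<kappa> (Suc n) u))"
        unfolding x_def using norm_pa_Suc_bounds(2)[OF \<kappa> u, of n] pos[OF ku, of n]
        by (intro ln_mono) (auto simp del: prodpair.simps)
      ultimately show ?thesis using pos[OF uc, of "Suc n"] pos[OF ku, of n]
        by (simp add: ln_mult x_def y_def del: prodpair.simps)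
    qed
    have "(\<lambda>n. 1 / real n * y (Suc n) - 1 / real n * x n) \<longlonglongrightarrow> 0"
    proof (rule tendsto_rabs_zero_cancel, rule tendsto_sandwich[OF _ _ tendsto_const])
      show "\<forall>\<^sub>F n in sequentially. 0 \<le> \<bar>1 / real n * y (Suc n) - 1 / real n * x n\<bar>" by simp
      show "\<forall>\<^sub>F n in sequentially. \<bar>1 / real n * y (Suc n) - 1 / real n * x n\<bar> \<le> 1 / real n * ln 2"
        by (intro always_eventually allI)
          (simp only: right_diff_distrib[symmetric] abs_mult, use xy in \<open>auto intro!: divide_right_mono\<close>)
      show "(\<lambda>n. 1 / real n * ln 2) \<longlonglongrightarrow> 0" by real_asymp
    qed
    moreover have "(\<lambda>n. 1 / real n * x n) \<longlonglongrightarrow> \<psi> (\<kappa> * u)" unfolding x_def by (rule lim[OF ku])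
    ultimately have A: "(\<lambda>n. 1 / real n * y (Suc n)) \<longlonglongrightarrow> 0 + \<psi> (\<kappa> * u)"
      using tendsto_add by fastforce
    \<comment> \<open>The shifted sequence is normalised by n instead of n + 1; the quotient of the
      two tends to 1.\<close>
    have "(\<lambda>n. real (Suc n) / real n * (1 / real (Suc n) * y (Suc n))) \<longlonglongrightarrow> 1 * \<psi> u"
    proof (rule tendsto_mult)
      show "(\<lambda>n. real (Suc n) / real n) \<longlonglongrightarrow> 1" by real_asymp
      show "(\<lambda>n. 1 / real (Suc n) * y (Suc n)) \<longlonglongrightarrow> \<psi> u"
        unfolding y_def by (rule LIMSEQ_Suc[OF lim[OF uc]])
    qed
    then have "(\<lambda>n. 1 / real n * y (Suc n)) \<longlonglongrightarrow> \<psi> u" by (simp del: of_nat_Suc)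
    with A show ?thesis by (simp add: LIMSEQ_unique)
  qed
  \<comment> \<open>The point of large growth depends on n, so uniformity is essential: for one
    large n every normalised logarithm would be below ln (5/4), while \<open>prodpair_growth\<close>
    supplies a point where it is not.\<close>
  have "\<exists>v\<in>circle. \<psi> v > 0"
  proof (rule ccontr)
    assume "\<not> ?thesis"
    then have np: "\<psi> v \<le> 0" if "v \<in> circle" for v using that by force
    have "0 < ln (5/4 :: real)" by simp
    then have "\<forall>\<^sub>F n in sequentially. n > 0 \<and>
        (\<forall>u\<in>circle. dist (1 / real n * ln (cmod (pa \<kappa> n u))) (\<psi> u) < ln (5/4))"
      by (intro eventually_conj eventually_gt_at_top uniform_limitD[OF unif])
    then obtain n where
      n: "n > 0" "\<And>u. u \<in> circle \<Longrightarrow> dist (1 / real n * ln (cmod (pa \<kappa> n u))) (\<psi> u) < ln (5/4)"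
      by (auto dest: eventually_happens)
    obtain u where u: "u \<in> circle" "(5/4) ^ n \<le> cmod (pa \<kappa> n u)"
      using prodpair_growth[OF \<kappa>] by blast
    have "real n * ln (5/4) = ln ((5/4) ^ n)" by (simp add: ln_realpow)
    also have "\<dots> \<le> ln (cmod (pa \<kappa> n u))" using u(2) by (intro ln_mono) auto
    finally have "ln (5/4) \<le> 1 / real n * ln (cmod (pa \<kappa> n u))"
      using n(1) by (simp add: field_simps)
    with n(2)[OF u(1)] np[OF u(1)] show False by (simp add: dist_real_def)
  qed
  moreover have "\<exists>u\<in>circle. \<psi> u \<le> 0"
  proof (rule ccontr)
    assume "\<not> ?thesis"
    then have ps: "\<psi> v > 0" if "v \<in> circle" for v using that by force
    have "\<exists>u0\<in>circle. \<forall>u\<in>circle. \<psi> u0 \<le> \<psi> u"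
      by (rule continuous_attains_inf[OF _ _ cont]) auto
    then obtain u0 where u0: "u0 \<in> circle" "\<And>u. u \<in> circle \<Longrightarrow> \<psi> u0 \<le> \<psi> u" by blast
    \<comment> \<open>Half of the minimum of \<open>\<psi>\<close>: the other half absorbs the
      uniform error.\<close>
    define \<delta> where "\<delta> = \<psi> u0 / 2"
    have \<delta>: "\<delta> > 0" using ps[OF u0(1)] by (simp add: \<delta>_def)
    show False
    proof (rule prodpair_not_uniformly_growing[OF \<kappa> \<delta>])
      show "\<forall>\<^sub>F n in sequentially. \<forall>u\<in>circle. exp (real n * \<delta>) \<le> cmod (pa \<kappa> n u)"
        using uniform_limitD[OF unif \<delta>] eventually_gt_at_top[of 0]
      proof eventually_elim
        case (elim n)
        show ?case
        proof
          fix u assume u: "u \<in> circle"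
          have "\<delta> \<le> 1 / real n * ln (cmod (pa \<kappa> n u))"
            using elim(1)[rule_format, OF u] u0(2)[OF u] unfolding dist_real_def \<delta>_def by linarith
          then have "real n * \<delta> \<le> ln (cmod (pa \<kappa> n u))" using elim(2) by (simp add: field_simps)
          then show "exp (real n * \<delta>) \<le> cmod (pa \<kappa> n u)"
            using pos(2)[OF u] by (metis exp_le_cancel_iff exp_ln)
        qed
      qed
    qed
  qed
  ultimately show "\<exists>u\<in>circle. \<exists>v\<in>circle. \<psi> u < \<psi> v" by (meson le_less_trans)
qed

section \<open>The matrix cocycle\<close>

text \<open>Coordinates \<open>i\<close> and \<open>j\<close> are read as real and imaginary part,
  so that matrix products turn into the product rule for pairs (a, b).\<close>

definition block_map :: "'m \<Rightarrow> 'm \<Rightarrow> complex \<Rightarrow> complex \<Rightarrow> real ^ 'm \<Rightarrow> real ^ 'm::finite" where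
  "block_map i j a b v = (\<chi> k.
     if k = i then Re (a * Complex (v $ i) (v $ j) + b * cnj (Complex (v $ i) (v $ j)))
     else if k = j then Im (a * Complex (v $ i) (v $ j) + b * cnj (Complex (v $ i) (v $ j)))
     else v $ k)"

lemma linear_block_map: "linear (block_map i j a b)"
  by (rule linearI) (auto simp: block_map_def vec_eq_iff algebra_simps)

lemma block_map_compose:
  assumes "i \<noteq> j"
  shows "block_map i j a b (block_map i j a' b' v)
    = block_map i j (a * a' + b * cnj b') (a * b' + b * cnj a') v"
  using assms by (auto simp: block_map_def vec_eq_iff algebra_simps)

lemma block_map_1_0: "block_map i j 1 0 v = v"
  by (auto simp: block_map_def vec_eq_iff)

lemma matrix_block_map_compose:
  assumes "i \<noteq> j"
  shows "matrix (block_map i j a b) ** matrix (block_map i j a' b')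
    = matrix (block_map i j (a * a' + b * cnj b') (a * b' + b * cnj a'))"
  by (simp add: matrix_compose[symmetric] linear_block_map o_def block_map_compose[OF assms])

text \<open>With determinant 1 the inverse is encoded by the pair
  \<open>(cnj a, - b)\<close>.\<close>

lemma invertible_block_map:
  assumes "i \<noteq> j" and "a * cnj a - b * cnj b = 1"
  shows "invertible (matrix (block_map i j a b))"
proof -
  have "cnj a * a - cnj b * b = 1" using assms(2) by (simp add: mult.commute)
  have I: "matrix (block_map i j 1 0) = mat 1"
    by (metis block_map_1_0 ext id_apply matrix_id_mat_1 eq_id_iff)
  have "matrix (block_map i j a b) ** matrix (block_map i j (cnj a) (- b)) = mat 1"
    using assms(2) by (simp add: matrix_block_map_compose[OF assms(1)] I mult.commute)
  moreover have "matrix (block_map i j (cnj a) (- b)) ** matrix (block_map i j a b) = mat 1"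
    using assms(2) by (simp add: matrix_block_map_compose[OF assms(1)] I mult.commute)
  ultimately show ?thesis unfolding invertible_def by blast
qed

text \<open>The unit vectors along \<open>i\<close> and \<open>j\<close> represent 1 and the
  imaginary unit, with planar images a + b and i (a - b). Since (a + b) + (a - b) = 2 a, they cannot
  both be short.\<close>

lemma onorm_block_map_lower:
  fixes i j :: "'m::finite"
  assumes "i \<noteq> j"
  shows "cmod a / 2 \<le> onorm (block_map i j a b)"
proof -
  have bl: "bounded_linear (block_map i j a b)"
    by (simp add: linear_block_map linear_conv_bounded_linear[symmetric])
  have le: "norm (block_map i j a b v) \<le> onorm (block_map i j a b)" if "norm v = 1" for v
    using onorm[OF bl, of v] that by simp
  have cm: "cmod w \<le> 2 * norm (block_map i j a b v)"
    if "w = a * Complex (v $ i) (v $ j) + b * cnj (Complex (v $ i) (v $ j))" for w v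
  proof -
    have "\<bar>Re w\<bar> \<le> norm (block_map i j a b v)" "\<bar>Im w\<bar> \<le> norm (block_map i j a b v)"
      using component_le_norm_cart[of "block_map i j a b v" i]
        component_le_norm_cart[of "block_map i j a b v" j] assms
      by (simp_all add: block_map_def that)
    then show ?thesis using cmod_le[of w] by linarith
  qed
  have "cmod (a + b) \<le> 2 * onorm (block_map i j a b)"
  proof -
    have "cmod (a + b) \<le> 2 * norm (block_map i j a b (axis i 1))"
      using assms by (intro cm) (simp add: axis_def complex_eq_iff)
    then show ?thesis using le[of "axis i 1"] by simp
  qed
  moreover have "cmod (\<i> * (a - b)) \<le> 2 * onorm (block_map i j a b)"
  proof -
    have "cmod (\<i> * (a - b)) \<le> 2 * norm (block_map i j a b (axis j 1))"
      using assms by (intro cm) (simp add: axis_def complex_eq_iff)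
    then show ?thesis using le[of "axis j 1"] by simp
  qed
  moreover have "cmod ((a + b) + (a - b)) \<le> cmod (a + b) + cmod (a - b)" by (rule norm_triangle_ineq)
  moreover have "(a + b) + (a - b) = 2 * a" by simp
  ultimately show ?thesis by (simp add: norm_mult)
qed

text \<open>A crude constant suffices, as any factor independent of n and x vanishes in the growth
  rate. The bound 1 on |a| from below takes care of the coordinates that are left fixed.\<close>

lemma onorm_block_map_upper:
  fixes i j :: "'m::finite"
  assumes "1 \<le> cmod a" "cmod b \<le> cmod a"
  shows "onorm (block_map i j a b) \<le> 4 * real CARD('m) * cmod a"
proof (rule onorm_le)
  fix v :: "real ^ 'm"
  define z where "z = Complex (v $ i) (v $ j)"
  define w where "w = a * z + b * cnj z"
  have "cmod z \<le> \<bar>v $ i\<bar> + \<bar>v $ j\<bar>" using cmod_le[of z] by (simp add: z_def)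
  then have z: "cmod z \<le> 2 * norm v"
    using component_le_norm_cart[of v i] component_le_norm_cart[of v j] by linarith
  have "cmod w \<le> cmod a * cmod z + cmod b * cmod z"
    unfolding w_def by (rule norm_triangle_le) (simp add: norm_mult)
  also have "\<dots> \<le> cmod a * (2 * norm v) + cmod a * (2 * norm v)"
    using z assms by (intro add_mono mult_mono) auto
  finally have w: "cmod w \<le> 4 * cmod a * norm v" by simp
  have other: "\<bar>v $ k\<bar> \<le> 4 * cmod a * norm v" for k
  proof -
    have "1 * norm v \<le> (4 * cmod a) * norm v" using assms by (intro mult_right_mono) auto
    then show ?thesis using component_le_norm_cart[of v k] by linarith
  qed
  have "norm (block_map i j a b v) \<le> (\<Sum>k\<in>UNIV. \<bar>block_map i j a b v $ k\<bar>)"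
    by (rule norm_le_l1_cart)
  also have "\<dots> \<le> (\<Sum>k\<in>(UNIV :: 'm set). 4 * cmod a * norm v)"
    using w other abs_Re_le_cmod[of w] abs_Im_le_cmod[of w]
    by (intro sum_mono) (auto simp: block_map_def simp flip: z_def w_def intro: order_trans)
  finally show "norm (block_map i j a b v) \<le> 4 * real CARD('m) * cmod a * norm v" by simp
qed

text \<open>The numbers 5/4 and 3/4 are half the sum and half the difference of the stretching
  factors 2 and 1/2.\<close>

definition stretch_cocycle :: "'m \<Rightarrow> 'm \<Rightarrow> (complex \<Rightarrow> complex) \<Rightarrow> complex \<Rightarrow> real ^ 'm ^ 'm::finite" where
  "stretch_cocycle i j h x = matrix (block_map i j (5/4 * h x) (3/4 * cnj (h x)))"

lemma stretch_cocycle_GL: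
  assumes "i \<noteq> j" "continuous_on X h" "\<And>x. x \<in> X \<Longrightarrow> h x \<in> circle"
  shows "stretch_cocycle i j h \<in> continuous_GL_maps X"
  unfolding continuous_GL_maps_def
proof (intro CollectI conjI ballI)
  show "continuous_on X (stretch_cocycle i j h)"
    unfolding stretch_cocycle_def matrix_def block_map_def
  proof (intro continuous_on_vec_lambda)
    fix k l :: 'a
    show "continuous_on X (\<lambda>x. (\<chi> k.
       if k = i then Re (5/4 * h x * Complex (axis l 1 $ i) (axis l 1 $ j) + 3/4 * cnj (h x) * cnj (Complex (axis l 1 $ i) (axis l 1 $ j)))
       else if k = j then Im (5/4 * h x * Complex (axis l 1 $ i) (axis l 1 $ j) + 3/4 * cnj (h x) * cnj (Complex (axis l 1 $ i) (axis l 1 $ j)))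
       else axis l 1 $ k) $ k)"
      by (cases "k = i"; cases "k = j") (auto intro!: continuous_intros assms(2))
  qed
  show "invertible (stretch_cocycle i j h x)" if "x \<in> X" for x
    unfolding stretch_cocycle_def
  proof (rule invertible_block_map[OF assms(1)])
    have "h x * cnj (h x) = 1" using assms(3)[OF that] by (intro unit_mult_cnj) simp
    then show "5/4 * h x * cnj (5/4 * h x) - 3/4 * cnj (h x) * cnj (3/4 * cnj (h x)) = 1"
      by (simp add: field_simps)
  qed
qed

text \<open>Along the orbit of \<open>x\<close> the semiconjugacy \<open>h\<close> takes the values
  \<open>\<kappa> ^ n * h x\<close>, exactly the rotations entering the recursion of
  \<open>prodpair\<close>.\<close>

lemma cocycle_stretch_cocycle:
  assumes "i \<noteq> j" and f: "\<And>x. x \<in> X \<Longrightarrow> f x \<in> X" and h: "\<And>x. x \<in> X \<Longrightarrow> h (f x) = \<kappa> * h x"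
    and x: "x \<in> X"
  shows "cocycle f (stretch_cocycle i j h) n x = matrix (block_map i j (pa \<kappa> n (h x)) (pb \<kappa> n (h x)))"
proof (induction n)
  case 0
  have "block_map i j 1 0 = id" by (auto simp: block_map_1_0)
  then show ?case using matrix_id_mat_1 by (metis cocycle.simps(1) fst_conv prodpair.simps(1) snd_conv)
next
  case (Suc n)
  have "(f ^^ n) x \<in> X \<and> h ((f ^^ n) x) = \<kappa> ^ n * h x"
    by (induction n) (use f h x in \<open>auto simp: mult_ac\<close>)
  then show ?case
    by (simp add: Suc stretch_cocycle_def[of i j h "(f ^^ n) x"] matrix_block_map_compose[OF assms(1)])
qed

text \<open>The operator norm agrees with the modulus of \<open>pa\<close> at \<open>h x\<close> up
  to a fixed factor, so uniform convergence descends from \<open>X\<close> to the circle along the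
  surjection \<open>h\<close>.\<close>

lemma uniform_stretch_cocycleD:
  fixes i j :: "'m::finite"
  assumes ij: "i \<noteq> j" and f: "\<And>x. x \<in> X \<Longrightarrow> f x \<in> X" and h: "\<And>x. x \<in> X \<Longrightarrow> h (f x) = \<kappa> * h x"
    and \<kappa>: "cmod \<kappa> = 1" and surj: "h ` X = circle"
    and unif: "uniform_cocycle X f (stretch_cocycle i j h)"
  obtains \<psi> where "uniform_limit circle (\<lambda>n u. 1 / real n * ln (cmod (pa \<kappa> n u))) \<psi> sequentially"
proof -
  \<comment> \<open>\<open>K\<close> is the constant of the upper norm bound; being at least 2, it
    also covers the factor 1/2 of the lower one.\<close>
  define K where "K = 4 * real CARD('m)"
  have "1 \<le> real CARD('m)" by (simp add: Suc_leI)
  then have K: "2 \<le> K" unfolding K_def by linarith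
  define N where "N n x = onorm (\<lambda>v. cocycle f (stretch_cocycle i j h) n x *v v)" for n x
  have bound: "\<bar>ln (N n x) - ln (cmod (pa \<kappa> n (h x)))\<bar> \<le> ln K" if x: "x \<in> X" for n x
  proof -
    have u: "cmod (h x) = 1" using surj x by auto
    define a b where "a = pa \<kappa> n (h x)" and "b = pb \<kappa> n (h x)"
    have ab: "1 \<le> cmod a" "cmod b \<le> cmod a"
      unfolding a_def b_def using norm_pa_ge_1[OF \<kappa> u] norm_pb_le_pa[OF \<kappa> u] by auto
    have "cocycle f (stretch_cocycle i j h) n x = matrix (block_map i j a b)"
      unfolding a_def b_def
      by (rule cocycle_stretch_cocycle[where X = X, OF ij]) (use f h x in auto)
    then have "N n x = onorm (block_map i j a b)"
      by (simp add: N_def matrix_works linear_block_map)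
    then have N: "cmod a / 2 \<le> N n x" "N n x \<le> K * cmod a"
      using onorm_block_map_lower[OF ij, of a b] onorm_block_map_upper[OF ab, of i j]
      by (simp_all add: K_def)
    have "0 < N n x" using N(1) ab(1) by linarith
    have "ln (N n x) \<le> ln (K * cmod a)" using N(2) \<open>0 < N n x\<close> by (intro ln_mono) auto
    moreover have "cmod a \<le> K * N n x"
      using N(1) K mult_right_mono[of 2 K "N n x"] \<open>0 < N n x\<close> by linarith
    then have "ln (cmod a) \<le> ln (K * N n x)" using ab by (intro ln_mono) auto
    moreover have "a \<noteq> 0" using ab by auto
    ultimately show ?thesis
      using K \<open>0 < N n x\<close> unfolding a_def[symmetric] by (simp add: ln_mult abs_le_iff)
  qed
  obtain \<phi> where \<phi>: "uniform_limit X (\<lambda>n x. 1 / real n * ln (N n x)) \<phi> sequentially"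
    using unif by (auto simp: uniform_cocycle_def uniformly_convergent_on_def N_def)
  \<comment> \<open>Any preimage of \<open>u\<close> will do: the \<open>pa\<close> sequence to be
    approximated depends on \<open>u\<close> alone.\<close>
  define \<psi> where "\<psi> u = \<phi> (inv_into X h u)" for u
  have "uniform_limit circle (\<lambda>n u. 1 / real n * ln (cmod (pa \<kappa> n u))) \<psi> sequentially"
  proof (rule uniform_limitI)
    fix e :: real assume "e > 0"
    have "(\<lambda>n. 1 / real n * ln K) \<longlonglongrightarrow> 0" by real_asymp
    then have "\<forall>\<^sub>F n in sequentially. 1 / real n * ln K < e / 2"
      using \<open>e > 0\<close> by (intro order_tendstoD(2)) auto
    moreover have "\<forall>\<^sub>F n in sequentially. \<forall>x\<in>X. dist (1 / real n * ln (N n x)) (\<phi> x) < e / 2"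
      using \<open>e > 0\<close> by (intro uniform_limitD[OF \<phi>]) simp
    ultimately show "\<forall>\<^sub>F n in sequentially. \<forall>u\<in>circle.
        dist (1 / real n * ln (cmod (pa \<kappa> n u))) (\<psi> u) < e"
    proof eventually_elim
      case (elim n)
      show ?case
      proof
        fix u :: complex assume "u \<in> circle"
        then have "u \<in> h ` X" using surj by simp
        define x where "x = inv_into X h u"
        have x: "x \<in> X" "h x = u"
          unfolding x_def using \<open>u \<in> h ` X\<close> by (auto intro: inv_into_into f_inv_into_f)
        have "\<bar>1 / real n * ln (cmod (pa \<kappa> n u)) - 1 / real n * ln (N n x)\<bar>
            = 1 / real n * \<bar>ln (N n x) - ln (cmod (pa \<kappa> n (h x)))\<bar>"
          by (simp add: x abs_minus_commute flip: diff_divide_distrib)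
        also have "\<dots> \<le> 1 / real n * ln K"
          using bound[OF x(1)] by (intro mult_left_mono) auto
        also have "\<dots> < e / 2" using elim by simp
        finally show "dist (1 / real n * ln (cmod (pa \<kappa> n u))) (\<psi> u) < e"
          using elim(2)[rule_format, OF x(1)] unfolding dist_real_def \<psi>_def x_def[symmetric] by linarith
      qed
    qed
  qed
  then show thesis by (rule that)
qed

section \<open>Lifts of circle maps and invariant measures\<close>

text \<open>Period 1 instead of 2 pi makes the ambiguity of a lift an integer and matches the total
  mass of a probability measure.\<close>

definition circ :: "real \<Rightarrow> complex" where
  "circ t = cis (2 * pi * t)"

lemma circ_in_circle [simp]: "circ t \<in> circle" "cmod (circ t) = 1"
  by (simp_all add: circ_def)

lemma circ_nonzero [simp]: "circ t \<noteq> 0"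
  by (simp add: circ_def)

lemma circ_add: "circ (s + t) = circ s * circ t"
  by (simp add: circ_def distrib_left cis_mult)

lemma circ_of_int [simp]: "circ (of_int k) = 1"
  using cis_2pi cis_multiple_2pi[of "of_int k"] by (simp add: circ_def)

lemma circ_1 [simp]: "circ 1 = 1"
  by (simp add: circ_def)

lemma circ_eq_iff: "circ s = circ t \<longleftrightarrow> (\<exists>k::int. s = t + of_int k)"
proof
  assume "circ s = circ t"
  then have "cis (2 * pi * (s - t)) = 1"
    unfolding circ_def right_diff_distrib cis_divide[symmetric] by simp
  then obtain k :: int where "2 * pi * (s - t) = of_int k * (2 * pi)"
    by (auto simp: cis.ctr complex_eq_iff cos_one_2pi_int mult_ac)
  then have "2 * pi * (s - t) = 2 * pi * of_int k" by (simp only: mult.commute)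
  then have "s - t = of_int k" by (subst (asm) mult_cancel_left) simp
  then have "s = t + of_int k" by simp
  then show "\<exists>k::int. s = t + of_int k" ..
qed (auto simp: circ_add)

lemma continuous_on_circ [continuous_intros]:
  "continuous_on S g \<Longrightarrow> continuous_on S (\<lambda>x. circ (g x))"
  unfolding circ_def by (intro continuous_intros)

lemma circ_surj:
  assumes "z \<in> circle" obtains t where "0 \<le> t" "t < 1" "z = circ t"
proof
  have "0 \<le> Arg2pi z" "Arg2pi z < 2 * pi" by (rule Arg2pi_ge_0 Arg2pi_lt_2pi)+
  then show "0 \<le> Arg2pi z / (2 * pi)" "Arg2pi z / (2 * pi) < 1" by simp_all
  show "z = circ (Arg2pi z / (2 * pi))"
    using Arg2pi_eq[of z] assms by (simp add: circ_def cis_conv_exp)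
qed

section \<open>Points and invariant sets under a uniquely ergodic measure\<close>

lemma non_atomic_singleton:
  assumes "borel_prob_on X M" "non_atomic M" "x \<in> X" "{x} \<in> sets M"
  shows "emeasure M {x} = 0"
proof (rule ccontr)
  assume "emeasure M {x} \<noteq> 0"
  then have "atom_of M {x}"
    using assms(4) unfolding atom_of_def by (auto simp: zero_less_iff_neq_zero subset_singleton_iff)
  with assms(2) show False by (auto simp: non_atomic_def)
qed

lemma space_borel_prob_on: "borel_prob_on X M \<Longrightarrow> space M = X"
  using sets_eq_imp_space_eq[of M "restrict_space borel X"]
  by (simp add: borel_prob_on_def space_restrict_space)

lemma sets_borel_prob_on_closed:
  assumes "borel_prob_on X M" "closed X" "B \<in> sets borel" "B \<subseteq> X"
  shows "B \<in> sets M"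
  using assms by (auto simp: borel_prob_on_def sets_restrict_space_iff borel_closed)

text \<open>Conditioning \<open>M\<close> on \<open>B\<close> gives again an invariant probability
  measure, which must be \<open>M\<close> itself.\<close>

lemma uniquely_ergodic_invariant_set:
  assumes ue: "uniquely_ergodic X M f"
    and B: "B \<in> sets M" "f -` B \<inter> space M = B"
    and pos: "emeasure M B > 0"
  shows "emeasure M B = 1"
proof -
  interpret prob_space M using ue by (simp add: uniquely_ergodic_def borel_prob_on_def)
  have f: "f \<in> measurable M M" "\<And>C. C \<in> sets M \<Longrightarrow> emeasure M (f -` C \<inter> space M) = emeasure M C"
    using ue by (auto simp: uniquely_ergodic_def invariant_measure_def)
  let ?N = "uniform_measure M B"
  have "prob_space ?N"
    using pos by (intro prob_space_uniform_measure) auto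
  moreover have "invariant_measure f ?N"
    unfolding invariant_measure_def
  proof (intro conjI ballI)
    show "f \<in> measurable ?N ?N" using f(1) by simp
    fix C assume "C \<in> sets ?N"
    then have C: "C \<in> sets M" by simp
    have "B \<inter> (f -` C \<inter> space M) = f -` (B \<inter> C) \<inter> space M"
      using B(2) by auto
    then have "emeasure M (B \<inter> (f -` C \<inter> space M)) = emeasure M (B \<inter> C)"
      using f(2)[of "B \<inter> C"] B(1) C by simp
    then show "emeasure ?N (f -` C \<inter> space ?N) = emeasure ?N C"
      using B(1) C measurable_sets[OF f(1) C] by simp
  qed
  ultimately have "?N = M"
    using ue by (auto simp: uniquely_ergodic_def borel_prob_on_def)
  moreover have "emeasure ?N B = 1"
    using B(1) pos by (simp add: less_top[symmetric] ennreal_divide_self)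
  ultimately show ?thesis by simp
qed

text \<open>The point mass at a fixed point would be invariant, hence equal to \<open>M\<close>, and
  \<open>M\<close> would have an atom.\<close>

lemma uniquely_ergodic_non_atomic_no_fixpoint:
  assumes ue: "uniquely_ergodic X M f" and na: "non_atomic M"
    and x: "x \<in> X" "{x} \<in> sets M"
  shows "f x \<noteq> x"
proof
  assume fx: "f x = x"
  have bp: "borel_prob_on X M" and inv: "invariant_measure f M"
    using ue by (auto simp: uniquely_ergodic_def)
  have "x \<in> space M" using space_borel_prob_on[OF bp] x by simp
  then have "prob_space (return M x)" by (rule prob_space_return)
  moreover have "invariant_measure f (return M x)"
    unfolding invariant_measure_def
  proof (intro conjI ballI)
    show "f \<in> measurable (return M x) (return M x)"
      using inv by (simp add: invariant_measure_def)
    fix C assume "C \<in> sets (return M x)"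
    then have "C \<in> sets M" "f -` C \<inter> space M \<in> sets M"
      using inv by (auto simp: invariant_measure_def)
    then show "emeasure (return M x) (f -` C \<inter> space (return M x)) = emeasure (return M x) C"
      using \<open>x \<in> space M\<close> fx by (simp add: indicator_def)
  qed
  ultimately have "return M x = M"
    using ue by (auto simp: uniquely_ergodic_def borel_prob_on_def)
  moreover have "emeasure (return M x) {x} = 1" using x by simp
  ultimately show False using non_atomic_singleton[OF bp na x] by simp
qed

text \<open>A lift \<open>F\<close> satisfies F (t + 1) = F t + d with d an integer. Injectivity of
  \<open>f\<close> excludes d = 0 and d at least 2, and a negative d would create a fixed point, so
  d = 1.\<close>

lemma circle_homeomorphism_lift:
  assumes homeo: "homeomorphism circle circle f g"
    and nofix: "\<And>x. x \<in> circle \<Longrightarrow> f x \<noteq> x"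
  obtains F where "continuous_on UNIV F" "strict_mono F"
    "\<And>t. F (t + 1) = F t + 1" "\<And>t. f (circ t) = circ (F t)"
proof -
  have inj: "inj_on f circle"
    using homeo by (metis homeomorphism_def inj_on_inverseI)
  have img: "f x \<in> circle" if "x \<in> circle" for x
    using homeo that by (auto simp: homeomorphism_def)
  have "continuous_on UNIV (\<lambda>t. f (circ t))"
    by (rule continuous_on_compose2[OF homeomorphism_cont1[OF homeo]])
      (auto intro!: continuous_intros)
  moreover have "cmod (f (circ t)) = 1" for t using img[of "circ t"] by simp
  ultimately obtain L where L: "continuous_on UNIV L" "\<And>t. f (circ t) = cis (L t)"
    by (rule unit_circle_lift) blast
  define F where "F t = L t / (2 * pi)" for t
  have contF: "continuous_on S F" for S
    unfolding F_def using L(1)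
    by (intro continuous_intros) (auto intro: continuous_on_subset)
  have F: "f (circ t) = circ (F t)" for t
    unfolding L(2) by (simp add: circ_def F_def)
  \<comment> \<open>This is injectivity of \<open>f\<close> on the circle, expressed modulo the
    integers on the line.\<close>
  have Fint: "(\<exists>k::int. F t = F s + of_int k) \<longleftrightarrow> (\<exists>k::int. t = s + of_int k)" for s t
  proof -
    have "circ (F t) = circ (F s) \<longleftrightarrow> circ t = circ s"
      using inj_on_eq_iff[OF inj circ_in_circle(1)[of t] circ_in_circle(1)[of s]] by (simp only: F)
    then show ?thesis by (simp only: circ_eq_iff)
  qed
  define d where "d = F 1 - F 0"
  have per: "F (t + 1) = F t + d" for t
  proof -
    have "2 * pi * (F (t + 1) - F t) = 2 * pi * (F (0 + 1) - F 0)"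
    proof (rule continuous_cis_eq_1_constant[of "\<lambda>t. 2 * pi * (F (t + 1) - F t)"])
      show "continuous_on UNIV (\<lambda>t. 2 * pi * (F (t + 1) - F t))"
        by (intro continuous_intros contF continuous_on_compose2[OF contF]) auto
      have "circ (F (t + 1)) = circ (F t)" for t
        by (simp add: circ_add flip: F)
      then have "circ (F (t + 1) - F t) = 1" for t
        using circ_add[of "F (t + 1) - F t" "F t"] by simp
      then show "cis (2 * pi * (F (t + 1) - F t)) = 1" for t
        by (simp add: circ_def)
    qed
    then show ?thesis by (simp add: d_def)
  qed
  have "\<exists>k::int. F 1 = F 0 + of_int k" unfolding Fint by (rule exI[of _ 1]) simp
  then obtain d' :: int where d': "d = of_int d'" by (auto simp: d_def)
  have "d \<noteq> 0"
  proof
    assume "d = 0"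
    then have F01: "F 0 = F 1" by (simp add: d_def)
    \<comment> \<open>For d = 0 the intermediate value \<open>y\<close> is attained on both halves
      of [0,1], at two points strictly less than 1 apart, which \<open>Fint\<close> forbids.\<close>
    define y where "y = (F 0 + F (1/2)) / 2"
    have "\<nexists>k::int. (1/2 :: real) = of_int k"
    proof
      assume "\<exists>k::int. (1/2 :: real) = of_int k"
      then obtain k :: int where "(1/2 :: real) = of_int k" by blast
      then have "real_of_int (2 * k) = real_of_int 1" by simp
      then have "2 * k = 1" by (simp only: of_int_eq_iff)
      then show False by presburger
    qed
    then have half: "\<nexists>k::int. F (1/2) = F 0 + of_int k" unfolding Fint by simp
    then have "F (1/2) \<noteq> F 0" by (auto dest: spec[of _ 0])
    then have y: "y \<noteq> F 0" "y \<noteq> F (1/2)" by (auto simp: y_def)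
    have mid: "F 0 \<le> y \<and> y \<le> F (1/2) \<or> F (1/2) \<le> y \<and> y \<le> F 0"
      unfolding y_def by (simp add: field_simps) linarith
    then have "\<exists>t\<ge>0. t \<le> 1/2 \<and> F t = y"
      using IVT'[of F 0 y "1/2"] IVT2'[of F "1/2" y 0] contF by fastforce
    then obtain t1 where t1: "0 \<le> t1" "t1 \<le> 1/2" "F t1 = y" by blast
    have "\<exists>t\<ge>1/2. t \<le> 1 \<and> F t = y"
      using mid IVT'[of F "1/2" y 1] IVT2'[of F 1 y "1/2"] contF F01 by fastforce
    then obtain t2 where t2: "1/2 \<le> t2" "t2 \<le> 1" "F t2 = y" by blast
    have "t1 \<noteq> 0" "t1 \<noteq> 1/2" "t2 \<noteq> 1/2" "t2 \<noteq> 1" using t1(3) t2(3) y F01 by metis+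
    then have "0 < t2 - t1" "t2 - t1 < 1" using t1 t2 by auto
    moreover have "\<exists>k::int. F t2 = F t1 + of_int k" by (rule exI[of _ 0]) (simp add: t1 t2)
    then obtain k :: int where "t2 = t1 + of_int k" unfolding Fint by blast
    ultimately show False by simp
  qed
  moreover have "\<not> d < 0"
  proof
    assume "d < 0"
    then have "d' \<le> - 1" by (simp add: d')
    then have "real_of_int d' \<le> real_of_int (- 1)" by (simp only: of_int_le_iff)
    then have "d \<le> - 1" by (simp add: d')
    \<comment> \<open>Over [0,1] the function F t - t drops by at least 2, so it crosses the integer
      \<open>n\<close>, and the crossing projects to a fixed point of \<open>f\<close>.\<close>
    define n where "n = \<lfloor>F 0\<rfloor>"
    have n: "F 1 - 1 \<le> of_int n" "of_int n \<le> F 0 - 0"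
      using \<open>d \<le> - 1\<close> unfolding n_def d_def by linarith+
    have "\<exists>t\<ge>0. t \<le> 1 \<and> F t - t = of_int n"
      by (rule IVT2'[where f = "\<lambda>t. F t - t", OF n]) (auto intro!: continuous_intros contF)
    then obtain t where "F t = t + of_int n" by (auto simp: algebra_simps)
    then have "f (circ t) = circ t" by (simp add: F circ_add)
    then show False using nofix by simp
  qed
  ultimately have "d' \<ge> 1" by (simp add: d')
  \<comment> \<open>Otherwise F 0 + 1 is attained in [0,1]; by \<open>Fint\<close> only an endpoint
    can attain it, but the endpoint values are F 0 and F 0 + d.\<close>
  have "d < 2"
  proof (rule ccontr)
    assume "\<not> d < 2"
    then have "\<exists>t\<ge>0. t \<le> 1 \<and> F t = F 0 + 1"
      by (intro IVT' contF) (auto simp: d_def)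
    then obtain t where t: "0 \<le> t" "t \<le> 1" "F t = F 0 + 1" by blast
    then have "\<exists>k::int. F t = F 0 + of_int k" by (intro exI[of _ 1]) simp
    then obtain k :: int where "t = of_int k" unfolding Fint by auto
    with t(1,2) have "t = 0 \<or> t = 1" by auto
    then show False using t(3) \<open>\<not> d < 2\<close> by (auto simp: d_def)
  qed
  then have "d' < 2" by (simp add: d')
  with \<open>d' \<ge> 1\<close> have d1: "d = 1" by (simp add: d')
  have per_nat: "F (t + real n) = F t + real n" for t n
  proof (induction n)
    case (Suc n)
    have "F (t + real (Suc n)) = F ((t + real n) + 1)" by (simp add: add_ac)
    then show ?case using Suc by (simp add: per d1)
  qed simp
  have "inj F"
  proof (rule injI)
    fix s t assume eq: "F s = F t"
    then have "\<exists>k::int. F s = F t + of_int k" by (intro exI[of _ 0]) simp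
    then obtain k :: int where k: "s = t + of_int k" unfolding Fint by blast
    show "s = t"
    proof (cases "k \<ge> 0")
      case True
      then show ?thesis using per_nat[of t "nat k"] k eq by simp
    next
      case False
      then show ?thesis using per_nat[of s "nat (- k)"] k eq by simp
    qed
  qed
  then have "strict_mono_on UNIV F \<or> strict_antimono_on UNIV F"
    using injective_eq_monotone_map[of UNIV F] contF by simp
  moreover have "\<not> strict_antimono_on UNIV F"
  proof
    assume "strict_antimono_on UNIV F"
    then have "F 1 < F 0" by (simp add: monotone_on_def)
    then show False using d1 by (simp add: d_def)
  qed
  ultimately have "strict_mono F" by blast
  then show thesis
    using that[of F] contF per d1 F by simp
qed

text \<open>The distribution function of the periodic lift of \<open>M\<close> to the line: integrating
  \<open>\<lfloor>t - \<theta>\<rfloor>\<close> over the angles \<open>\<theta>\<close> counts the lifts of each point up to \<open>t\<close>.\<close>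

lemma circle_distribution_function:
  assumes bp: "borel_prob_on circle M" and na: "non_atomic M"
  obtains H :: "real \<Rightarrow> real" where "continuous_on UNIV H" "\<And>t. H (t + 1) = H t + 1"
    "\<And>s t. s \<le> t \<Longrightarrow> t \<le> s + 1 \<Longrightarrow> circ ` {s<..t} \<in> sets M"
    "\<And>s t. s \<le> t \<Longrightarrow> t \<le> s + 1 \<Longrightarrow> H t - H s = measure M (circ ` {s<..t})"
proof -
  interpret prob_space M using bp by (simp add: borel_prob_on_def)
  have space: "space M = circle" using space_borel_prob_on[OF bp] .
  define \<theta> where "\<theta> z = Arg z / (2 * pi)" for z
  have \<theta>: "circ (\<theta> z) = z" if "z \<in> circle" for z
    using rcis_cmod_Arg[of z] that by (simp add: \<theta>_def circ_def rcis_def)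
  \<comment> \<open>\<open>Arg\<close> jumps across the negative axis. Setting the value pi there
    gives a piecewise continuous function that agrees with \<open>Arg\<close> on the circle.\<close>
  have "(\<lambda>z. if z \<in> \<real>\<^sub>\<le>\<^sub>0 then pi else Arg z) \<in> borel_measurable borel"
  proof (rule borel_measurable_continuous_on_if)
    show "(\<real>\<^sub>\<le>\<^sub>0 :: complex set) \<in> sets borel" by (intro borel_closed closed_nonpos_Reals_complex)
    show "continuous_on (- \<real>\<^sub>\<le>\<^sub>0) (\<lambda>z. Arg z)"
      by (intro continuous_at_imp_continuous_on ballI continuous_at_Arg) auto
  qed auto
  then have "(\<lambda>z. if z \<in> \<real>\<^sub>\<le>\<^sub>0 then pi else Arg z) \<in> borel_measurable (restrict_space borel circle)"
    by (rule measurable_restrict_space1)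
  moreover have "sets M = sets (restrict_space borel circle)" using bp by (simp add: borel_prob_on_def)
  ultimately have "(\<lambda>z. if z \<in> \<real>\<^sub>\<le>\<^sub>0 then pi else Arg z) \<in> borel_measurable M"
    using measurable_cong_sets by blast
  moreover have "(if z \<in> \<real>\<^sub>\<le>\<^sub>0 then pi else Arg z) = Arg z" if "z \<in> space M" for z
  proof -
    have "Arg z = pi" if "z \<in> \<real>\<^sub>\<le>\<^sub>0"
      using that \<open>z \<in> space M\<close> by (auto simp: Arg_eq_pi space complex_nonpos_Reals_iff less_le cmod_eq_Re)
    then show ?thesis by simp
  qed
  ultimately have "Arg \<in> borel_measurable M"
    using measurable_cong[of M "\<lambda>z. if z \<in> \<real>\<^sub>\<le>\<^sub>0 then pi else Arg z" Arg borel] by blast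
  then have [measurable]: "\<theta> \<in> borel_measurable M" unfolding \<theta>_def by measurable
  have \<theta>_bound: "\<bar>\<theta> z\<bar> \<le> 1" for z
    using Arg_bounded[of z] by (simp add: \<theta>_def abs_le_iff field_simps)
  have floor_bound: "\<bar>real_of_int \<lfloor>t - \<theta> z\<rfloor>\<bar> \<le> \<bar>t\<bar> + 2" for t z
    using \<theta>_bound[of z] by linarith
  have int: "integrable M (\<lambda>z. real_of_int \<lfloor>t - \<theta> z\<rfloor>)" for t
    by (rule integrable_const_bound[of _ "\<bar>t\<bar> + 2"]) (use floor_bound in auto)
  define H where "H t = (\<integral>z. real_of_int \<lfloor>t - \<theta> z\<rfloor> \<partial>M)" for t
  have per: "H (t + 1) = H t + 1" for t
  proof -
    have "\<lfloor>t + 1 - \<theta> z\<rfloor> = \<lfloor>t - \<theta> z\<rfloor> + 1" for z by linarith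
    then show ?thesis unfolding H_def using int by (simp add: prob_space)
  qed
  \<comment> \<open>Over at most one period the floor increases by 0 or 1, and by 1 exactly when a
    lift of \<open>z\<close> lies in the half-open interval. The half-open form avoids counting a
    point twice when t = s + 1.\<close>
  have diff: "real_of_int \<lfloor>t - \<theta> z\<rfloor> - real_of_int \<lfloor>s - \<theta> z\<rfloor> = indicator (circ ` {s<..t}) z"
    if st: "s \<le> t" "t \<le> s + 1" "z \<in> circle" for s t z
  proof (cases "\<lfloor>s - \<theta> z\<rfloor> = \<lfloor>t - \<theta> z\<rfloor>")
    case True
    have "z \<notin> circ ` {s<..t}"
    proof
      assume "z \<in> circ ` {s<..t}"
      then obtain r where r: "s < r" "r \<le> t" "circ (\<theta> z) = circ r" using \<theta>[OF st(3)] by auto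
      then obtain k :: int where "\<theta> z = r + of_int k" by (auto simp: circ_eq_iff)
      with r have "s - \<theta> z < of_int (- k)" "of_int (- k) \<le> t - \<theta> z" by auto
      then have "\<lfloor>s - \<theta> z\<rfloor> < - k" "- k \<le> \<lfloor>t - \<theta> z\<rfloor>"
        by (simp_all only: floor_less_iff le_floor_iff)
      with True show False by linarith
    qed
    with True show ?thesis by simp
  next
    case False
    moreover have "\<lfloor>s - \<theta> z\<rfloor> \<le> \<lfloor>t - \<theta> z\<rfloor>" "\<lfloor>t - \<theta> z\<rfloor> \<le> \<lfloor>s - \<theta> z + 1\<rfloor>"
      using st by (intro floor_mono; simp)+
    ultimately have eq: "\<lfloor>t - \<theta> z\<rfloor> = \<lfloor>s - \<theta> z\<rfloor> + 1" by simp
    define r where "r = \<theta> z + of_int \<lfloor>t - \<theta> z\<rfloor>"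
    have "circ r = z" using \<theta>[OF st(3)] by (simp add: r_def circ_add)
    moreover have "r \<le> t" unfolding r_def using of_int_floor_le[of "t - \<theta> z"] by linarith
    moreover have "s < r" 
      using floor_correct[of "s - \<theta> z"] unfolding r_def eq of_int_add of_int_1 by linarith
    ultimately have "z \<in> circ ` {s<..t}" by force
    with eq show ?thesis by simp
  qed
  have sets: "circ ` {s<..t} \<in> sets M" if st: "s \<le> t" "t \<le> s + 1" for s t
  proof -
    have "circ ` {s<..t} = {z \<in> space M. real_of_int \<lfloor>t - \<theta> z\<rfloor> - real_of_int \<lfloor>s - \<theta> z\<rfloor> = 1}"
    proof (intro set_eqI iffI)
      fix z assume z: "z \<in> circ ` {s<..t}"
      then have "z \<in> circle" by auto
      with z diff[OF st this] show "z \<in> {z \<in> space M. real_of_int \<lfloor>t - \<theta> z\<rfloor> - real_of_int \<lfloor>s - \<theta> z\<rfloor> = 1}"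
        by (simp add: space)
    next
      fix z assume "z \<in> {z \<in> space M. real_of_int \<lfloor>t - \<theta> z\<rfloor> - real_of_int \<lfloor>s - \<theta> z\<rfloor> = 1}"
      then show "z \<in> circ ` {s<..t}"
        using diff[OF st, of z] by (auto simp: space indicator_def split: if_splits)
    qed
    also have "\<dots> \<in> sets M" by measurable
    finally show ?thesis .
  qed
  have measure: "H t - H s = measure M (circ ` {s<..t})" if st: "s \<le> t" "t \<le> s + 1" for s t
  proof -
    have "H t - H s = (\<integral>z. real_of_int \<lfloor>t - \<theta> z\<rfloor> - real_of_int \<lfloor>s - \<theta> z\<rfloor> \<partial>M)"
      unfolding H_def by (rule Bochner_Integration.integral_diff[symmetric]) (rule int)+
    also have "\<dots> = (\<integral>z. indicator (circ ` {s<..t}) z \<partial>M)"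
      by (rule Bochner_Integration.integral_cong) (use diff[OF st] space in auto)
    also have "\<dots> = measure M (circ ` {s<..t})"
      using sets[OF st] sets.sets_into_space[OF sets[OF st]] by (simp add: Int_absorb2)
    finally show ?thesis .
  qed
  \<comment> \<open>The integrand is discontinuous in its parameter at \<open>t\<close> only for z =
    \<open>circ t\<close>, a null set because \<open>M\<close> has no atoms; dominated convergence
    does the rest.\<close>
  have "isCont H t" for t
    unfolding continuous_at_sequentially comp_def
  proof (intro allI impI)
    fix X assume X: "X \<longlonglongrightarrow> t"
    then have "Bseq X" using convergent_imp_Bseq convergentI by blast
    then obtain K where K: "\<And>n. \<bar>X n\<bar> \<le> K" by (auto simp: Bseq_def)
    show "(\<lambda>n. H (X n)) \<longlonglongrightarrow> H t"
      unfolding H_def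
    proof (rule integral_dominated_convergence[where w = "\<lambda>_. K + 2"])
      have "{circ t} \<in> sets M"
        using sets_borel_prob_on_closed[OF bp, of "{circ t}"] by simp
      then have "{circ t} \<in> null_sets M"
        using non_atomic_singleton[OF bp na, of "circ t"] by auto
      then have "AE z in M. z \<notin> {circ t}" by (rule AE_not_in)
      then show "AE z in M. (\<lambda>n. real_of_int \<lfloor>X n - \<theta> z\<rfloor>) \<longlonglongrightarrow> real_of_int \<lfloor>t - \<theta> z\<rfloor>"
      proof (rule AE_mp, intro AE_I2 impI)
        fix z assume z: "z \<in> space M" "z \<notin> {circ t}"
        have "t - \<theta> z \<notin> \<int>"
        proof
          assume "t - \<theta> z \<in> \<int>"
          then obtain k :: int where "t = \<theta> z + of_int k" by (auto elim!: Ints_cases simp: algebra_simps)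
          then have "circ t = circ (\<theta> z)" by (simp add: circ_add)
          with \<theta>[of z] z space show False by simp
        qed
        then show "(\<lambda>n. real_of_int \<lfloor>X n - \<theta> z\<rfloor>) \<longlonglongrightarrow> real_of_int \<lfloor>t - \<theta> z\<rfloor>"
          by (intro tendsto_of_int_floor tendsto_diff X tendsto_const)
      qed
      show "AE z in M. norm (real_of_int \<lfloor>X n - \<theta> z\<rfloor>) \<le> K + 2" for n
        using floor_bound[of "X n"] K[of n] by (intro AE_I2) (simp, smt (verit))
    qed (use borel_measurable_integrable[OF int] in auto)
  qed
  then have "continuous_on UNIV H" by (simp add: continuous_at_imp_continuous_on)
  then show thesis using that per sets measure by blast
qed

text \<open>The distribution function \<open>H\<close> descends to \<open>h\<close>, and invariance
  of \<open>M\<close> turns the lift of \<open>f\<close> into a translation in the coordinate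
  \<open>H\<close>. The last two conclusions let open sets of the factor be measured through
  \<open>h\<close>.\<close>

lemma circle_factor_rotation:
  assumes homeo: "homeomorphism circle circle f g"
    and ue: "uniquely_ergodic circle M f" and na: "non_atomic M"
  obtains h \<kappa> where "continuous_on circle h" "h ` circle = circle" "cmod \<kappa> = 1"
    "\<And>x. x \<in> circle \<Longrightarrow> h (f x) = \<kappa> * h x"
    "\<And>V. openin (top_of_set circle) V \<Longrightarrow> h -` V \<inter> circle \<in> sets M"
    "\<And>V. openin (top_of_set circle) V \<Longrightarrow> V \<noteq> {} \<Longrightarrow> 0 < emeasure M (h -` V \<inter> circle)"
proof -
  have bp: "borel_prob_on circle M" using ue by (simp add: uniquely_ergodic_def)
  interpret prob_space M using bp by (simp add: borel_prob_on_def)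
  have space: "space M = circle" using space_borel_prob_on[OF bp] .
  have "{x} \<in> sets M" if "x \<in> circle" for x
    using that by (intro sets_borel_prob_on_closed[OF bp]) auto
  then have nofix: "f x \<noteq> x" if "x \<in> circle" for x
    using uniquely_ergodic_non_atomic_no_fixpoint[OF ue na that] that by blast
  obtain F where F: "continuous_on UNIV F" "strict_mono F"
      "\<And>t. F (t + 1) = F t + 1" "\<And>t. f (circ t) = circ (F t)"
    using circle_homeomorphism_lift[OF homeo nofix] by blast
  obtain H :: "real \<Rightarrow> real" where H: "continuous_on UNIV H" "\<And>t. H (t + 1) = H t + 1"
    and sets: "\<And>s t. s \<le> t \<Longrightarrow> t \<le> s + 1 \<Longrightarrow> circ ` {s<..t} \<in> sets M"
    and Hdiff: "\<And>s t. s \<le> t \<Longrightarrow> t \<le> s + 1 \<Longrightarrow> H t - H s = measure M (circ ` {s<..t})"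
    using circle_distribution_function[OF bp na] by blast
  have contH: "continuous_on S H" for S using H(1) continuous_on_subset by blast
  have mono: "H s \<le> H t" if "s \<le> t" "t \<le> s + 1" for s t
    using Hdiff[OF that] measure_nonneg[of M "circ ` {s<..t}"] by linarith
  have per_nat: "H (t + real n) = H t + real n" for t n
  proof (induction n)
    case (Suc n)
    have "H (t + real (Suc n)) = H ((t + real n) + 1)" by (simp add: add_ac)
    then show ?case using Suc by (simp add: H(2))
  qed simp
  have per: "H (t + of_int k) = H t + of_int k" for t k
  proof (cases "k \<ge> 0")
    case True
    then show ?thesis using per_nat[of t "nat k"] by simp
  next
    case False
    then show ?thesis using per_nat[of "t + of_int k" "nat (- k)"] by simp
  qed
  have Hsurj: "\<exists>s. H s = y" for y
  proof -
    define n where "n = \<lfloor>y - H 0\<rfloor>"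
    have "H 0 \<le> y - of_int n" "y - of_int n \<le> H 1"
      using H(2)[of 0] unfolding n_def by simp_all linarith+
    then obtain r where "H r = y - of_int n"
      using IVT'[of H 0 "y - of_int n" 1] contH by auto
    then have "H (r + of_int n) = y" by (simp add: per)
    then show ?thesis ..
  qed

  \<comment> \<open>The lift chosen by \<open>SOME\<close> is irrelevant, since \<open>H\<close>
    commutes with integer translations.\<close>
  define h where "h z = circ (H (SOME t. circ t = z))" for z
  have h: "h (circ t) = circ (H t)" for t
  proof -
    have "circ (SOME s. circ s = circ t) = circ t" by (rule someI) (rule refl)
    then obtain k :: int where "(SOME s. circ s = circ t) = t + of_int k" by (auto simp: circ_eq_iff)
    then show ?thesis by (simp add: h_def per circ_add)
  qed
  \<comment> \<open>Each closed preimage is the image of a compact subset of [0,1], so no continuous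
    local inverse of \<open>circ\<close> has to be chosen.\<close>
  have "closed (h -` B \<inter> circle)" if "closed B" for B
  proof -
    have "h -` B \<inter> circle = circ ` ({0..1} \<inter> (\<lambda>t. circ (H t)) -` B)"
    proof (intro set_eqI iffI)
      fix z assume z: "z \<in> h -` B \<inter> circle"
      then obtain t where "0 \<le> t" "t < 1" "z = circ t" using circ_surj by blast
      with z show "z \<in> circ ` ({0..1} \<inter> (\<lambda>t. circ (H t)) -` B)" by (auto simp: h)
    qed (auto simp: h)
    moreover have "compact ({0..1} \<inter> (\<lambda>t. circ (H t)) -` B)"
    proof (intro compact_Int_closed compact_Icc closed_vimage that)
      show "continuous_on UNIV (\<lambda>t. circ (H t))" by (intro continuous_intros contH)
    qed
    ultimately show ?thesis
      by (auto intro!: compact_imp_closed compact_continuous_image continuous_intros)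
  qed
  then have conth: "continuous_on circle h"
    by (subst continuous_on_closed_vimage) auto
  have imgh: "h ` circle = circle"
  proof (intro set_eqI iffI)
    fix w assume "w \<in> h ` circle"
    then show "w \<in> circle" using circ_surj h by (metis circ_in_circle(1) imageE)
  next
    fix w assume "w \<in> circle"
    then obtain y where "w = circ y" using circ_surj by blast
    moreover obtain s where "H s = y" using Hsurj by blast
    ultimately have "w = h (circ s)" by (simp add: h)
    then show "w \<in> h ` circle" by simp
  qed

  have inj: "inj_on f circle"
    using homeo by (metis homeomorphism_def inj_on_inverseI)
  have eq: "h (f x) = circ (H (F 0) - H 0) * h x" if "x \<in> circle" for x
  proof -
    obtain t where t: "0 \<le> t" "t < 1" "x = circ t" using circ_surj \<open>x \<in> circle\<close> by blast
    have "F 0 \<le> F t" "F t \<le> F (0 + 1)"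
      using t strict_mono_less_eq[OF F(2)] by auto
    then have Ft: "F 0 \<le> F t" "F t \<le> F 0 + 1" unfolding F(3) by auto
    have "F ` {0<..t} = {F 0<..F t}"
    proof (intro set_eqI iffI)
      fix y assume y: "y \<in> {F 0<..F t}"
      then obtain r where "0 \<le> r" "r \<le> t" "F r = y"
        using IVT'[of F 0 y t] t continuous_on_subset[OF F(1)] by auto
      with y show "y \<in> F ` {0<..t}" by (cases "r = 0") auto
    qed (use strict_mono_less[OF F(2)] strict_mono_less_eq[OF F(2)] in auto)
    then have img: "circ ` {F 0<..F t} = f ` circ ` {0<..t}"
      by (simp add: image_image F(4) flip: \<open>F ` {0<..t} = {F 0<..F t}\<close>)
    \<comment> \<open>Invariance concerns preimages; injectivity of \<open>f\<close> converts it
      into equal mass of an arc and its image.\<close>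
    have "f -` f ` circ ` {0<..t} \<inter> circle = circ ` {0<..t}"
      using inj by (auto dest: inj_onD)
    moreover have "emeasure M (f -` B \<inter> circle) = emeasure M B" if "B \<in> sets M" for B
      using ue that by (auto simp: uniquely_ergodic_def invariant_measure_def space)
    ultimately have "emeasure M (circ ` {F 0<..F t}) = emeasure M (circ ` {0<..t})"
      using sets[OF Ft] unfolding img by metis
    then have "H (F t) - H (F 0) = H t - H 0"
      using Hdiff[OF Ft] Hdiff[of 0 t] t by (simp add: measure_def)
    then have "H (F t) = (H (F 0) - H 0) + H t" by simp
    then show ?thesis by (simp only: t(3) F(4) h circ_add)
  qed

  have meas: "h -` V \<inter> circle \<in> sets M" if "openin (top_of_set circle) V" for V
  proof -
    obtain W where "open W" "V = circle \<inter> W" using \<open>openin _ V\<close> by (auto simp: openin_open)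
    then have "h -` V \<inter> circle = h -` W \<inter> circle" using imgh by auto
    moreover have "openin (top_of_set circle) (circle \<inter> h -` W)"
      by (rule continuous_openin_preimage_gen[OF conth \<open>open W\<close>])
    then obtain W' where "open W'" "circle \<inter> h -` W = circle \<inter> W'" by (auto simp: openin_open)
    ultimately have "h -` V \<inter> circle = circle \<inter> W'" by auto
    also have "\<dots> \<in> sets M"
      using \<open>open W'\<close> by (intro sets_borel_prob_on_closed[OF bp]) auto
    finally show ?thesis .
  qed
  have pos: "0 < emeasure M (h -` V \<inter> circle)"
    if V: "openin (top_of_set circle) V" "V \<noteq> {}" for V
  proof -
    obtain W where W: "open W" "V = circle \<inter> W" using V(1) by (auto simp: openin_open)
    obtain u where u: "u \<in> V" using V(2) by blast
    obtain y where y: "u = circ y" using u W circ_surj by blast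
    have "open (circ -` W)"
      by (intro open_vimage W continuous_intros)
    moreover have "y \<in> circ -` W" using u W y by auto
    ultimately obtain e where e: "e > 0" "cball y e \<subseteq> circ -` W"
      unfolding open_contains_cball by blast
    \<comment> \<open>The bound 1 keeps the interval from s to t within one period, so that the
      corresponding arc has mass exactly \<open>d\<close>.\<close>
    define d where "d = min e 1"
    have d: "0 < d" "d \<le> 1" "\<And>r. y \<le> r \<Longrightarrow> r \<le> y + d \<Longrightarrow> circ r \<in> W"
      using e by (auto simp: d_def dist_real_def subset_eq)
    obtain s where s: "H s = y" using Hsurj by blast
    obtain t where t: "s \<le> t" "t \<le> s + 1" "H t = y + d"
      using IVT'[of H s "y + d" "s + 1"] s d contH H(2) by auto
    have "circ ` {s<..t} \<subseteq> h -` V \<inter> circle"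
    proof
      fix z assume "z \<in> circ ` {s<..t}"
      then obtain r where r: "s < r" "r \<le> t" "z = circ r" by auto
      then have "y \<le> H r" "H r \<le> y + d" using mono[of s r] mono[of r t] t s by auto
      then have "circ (H r) \<in> V" using d(3) W by simp
      then show "z \<in> h -` V \<inter> circle" using r by (simp add: h)
    qed
    then have "emeasure M (circ ` {s<..t}) \<le> emeasure M (h -` V \<inter> circle)"
      by (rule emeasure_mono) (rule meas[OF V(1)])
    moreover have "measure M (circ ` {s<..t}) = d" using Hdiff[OF t(1,2)] t s by simp
    then have "0 < emeasure M (circ ` {s<..t})" using d by (simp add: emeasure_eq_measure)
    ultimately show ?thesis by (rule less_le_trans[rotated])
  qed
  show thesis
    by (rule that[OF conth imgh _ eq meas pos]) simp_all
qed

section \<open>Incompatibility of ergodicity with a non-constant growth rate\<close>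

theorem proposition3p4:
  fixes f :: "complex \<Rightarrow> complex" and \<mu> :: "complex measure"
  assumes "\<exists>g. homeomorphism circle circle f g"
    and "uniquely_ergodic circle \<mu> f"
    and "non_atomic \<mu>"
    and "CARD('m::finite) \<ge> 2"
  shows "\<exists>A :: complex \<Rightarrow> real ^ 'm ^ 'm.
           A \<in> continuous_GL_maps circle \<and> \<not> uniform_cocycle circle f A"
proof -
  obtain g where g: "homeomorphism circle circle f g" using assms(1) by blast
  then have f: "f x \<in> circle" if "x \<in> circle" for x
    using that by (auto simp: homeomorphism_def)
  interpret prob_space \<mu> using assms(2) by (simp add: uniquely_ergodic_def borel_prob_on_def)
  have space: "space \<mu> = circle"
    using assms(2) by (intro space_borel_prob_on) (simp add: uniquely_ergodic_def)
  obtain h \<kappa> where conth: "continuous_on circle h" and imgh: "h ` circle = circle"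
    and \<kappa>: "cmod \<kappa> = 1" and h: "\<And>x. x \<in> circle \<Longrightarrow> h (f x) = \<kappa> * h x"
    and meas: "\<And>V. openin (top_of_set circle) V \<Longrightarrow> h -` V \<inter> circle \<in> sets \<mu>"
    and pos: "\<And>V. openin (top_of_set circle) V \<Longrightarrow> V \<noteq> {} \<Longrightarrow> 0 < emeasure \<mu> (h -` V \<inter> circle)"
    using circle_factor_rotation[OF g assms(2,3)] by blast
  have hc: "h x \<in> circle" if "x \<in> circle" for x using imgh that by blast
  have "\<exists>i j :: 'm. i \<noteq> j"
  proof (rule ccontr)
    assume "\<not> ?thesis"
    then have "CARD('m) \<le> 1" by (auto simp: card_le_Suc0_iff_eq)
    with assms(4) show False by simp
  qed
  then obtain i j :: 'm where ij: "i \<noteq> j" by blast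
  have "\<not> uniform_cocycle circle f (stretch_cocycle i j h)"
  proof
    assume "uniform_cocycle circle f (stretch_cocycle i j h)"
    then obtain \<psi> where unif: "uniform_limit circle (\<lambda>n u. 1 / real n * ln (cmod (pa \<kappa> n u))) \<psi> sequentially"
      using uniform_stretch_cocycleD[where X = circle and f = f and h = h and \<kappa> = \<kappa>, OF ij f h \<kappa> imgh] by blast
    note \<psi> = prodpair_growth_rate[OF \<kappa> unif]
    obtain u v where uv: "u \<in> circle" "v \<in> circle" "\<psi> u < \<psi> v" using \<psi>(3) by blast
    \<comment> \<open>A level strictly between two values of \<open>\<psi>\<close>: the sets where
      the rate at \<open>h x\<close> lies below and above it are disjoint, yet both will have full
      measure.\<close>
    define c where "c = (\<psi> u + \<psi> v) / 2"
    have c: "\<psi> u < c" "c < \<psi> v" using uv by (auto simp: c_def)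
    \<comment> \<open>Invariance of \<open>\<psi>\<close> under the rotation makes this preimage
      \<open>f\<close>-invariant. It has positive measure as \<open>h\<close> pulls back a nonempty
      open set, hence measure 1.\<close>
    have full: "h -` (circle \<inter> \<psi> -` W) \<inter> circle \<in> sets \<mu> \<and> emeasure \<mu> (h -` (circle \<inter> \<psi> -` W) \<inter> circle) = 1"
      if W: "open W" "w \<in> circle" "\<psi> w \<in> W" for W w
    proof -
      let ?V = "circle \<inter> \<psi> -` W"
      have V: "openin (top_of_set circle) ?V"
        by (rule continuous_openin_preimage_gen[OF \<psi>(1) W(1)])
      have "f -` (h -` ?V \<inter> circle) \<inter> space \<mu> = h -` ?V \<inter> circle"
        using f h hc \<psi>(2) by (auto simp: space norm_mult \<kappa>)
      moreover have "?V \<noteq> {}" using W by auto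
      ultimately show ?thesis
        using meas[OF V] uniquely_ergodic_invariant_set[OF assms(2) meas[OF V]] pos[OF V] by blast
    qed
    let ?A = "h -` (circle \<inter> \<psi> -` {..<c}) \<inter> circle" and ?B = "h -` (circle \<inter> \<psi> -` {c<..}) \<inter> circle"
    have A: "?A \<in> sets \<mu>" "emeasure \<mu> ?A = 1" using full[of "{..<c}" u] uv c by auto
    have B: "?B \<in> sets \<mu>" "emeasure \<mu> ?B = 1" using full[of "{c<..}" v] uv c by auto
    have "prob ?A + prob ?B = prob (?A \<union> ?B)"
      using A(1) B(1) by (intro finite_measure_Union[symmetric]) auto
    also have "\<dots> \<le> 1" by (rule prob_le_1)
    finally show False using A(2) B(2) by (simp add: measure_def)
  qed
  moreover have "stretch_cocycle i j h \<in> continuous_GL_maps circle"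
    by (rule stretch_cocycle_GL[OF ij conth hc])
  ultimately show ?thesis by blast
qed

end
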